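(* Let $\Lambda$ be a Legendrian knot in $(\mathbb{R}^3,\xi_{std})$ with a Lagrangian petal projection with $k$ half-twists and an $n$-multi-crossing, and let $h$ be the height function and $\sigma$ the associated sign function of this multi-crossing. Then the Thurston–Bennequin number of $\Lambda$ is \[ tb(\Lambda)=-k+\sum_{1\le i<j\le n}\sigma(i,j). \]
   Context: The standard contact structure on $\mathbb{R}^3$ with coordinates $(x,y,z)$ is $\xi_{std}=\ker(dz-y\,dx)$. A Legendrian knot is a knot whose tangent vector at each of its points $p$ lies in the plane of $\xi_{std}$ at $p$. The Lagrangian projection is the projection to the $xy$-plane; relative $z$-coordinates are recovered by $z(t_2)-z(t_1)=\int_{t_1}^{t_2}y(t)x'(t)\,dt$. The Thurston–Bennequin number is $tb(\Lambda)=\mathrm{writhe}(\Lambda)$, the writhe of the Lagrangian projection; when the projection has a multi-crossing, the writhe is computed after spreading the multi-crossing into ordinary double crossings, each pair of strands crossing exactly once. An $n$-multi-crossing of a knot projection is a point where $n$ strands intersect such that each strand bisects the crossing (so any two of the strands cross there). An übercrossing projection is a knot projection with a single multi-crossing and no other crossings. A petal projection is an übercrossing projection with no nested loops; its loops are called petals. A Lagrangian petal projection of a Legendrian knot is a petal projection in the Lagrangian projection, with possible half-twists on the petals. Here a half-twist on a petal is an additional self-crossing of that petal of the kind created by a Reidemeister I (R1) move producing a negative crossing; after removing the half-twists the diagram is a petal projection. The number of petals is taken to be odd (the paper notes that with at least two petals the number must be odd), and equals the number $n$ of strands at the multi-crossing. Labels and heights: label the strands at the multi-crossing $1,2,\ldots,n$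 from top to bottom according to their ends on the left of the crossing. The height function $h:\{1,\ldots,n\}\to\{1,\ldots,n\}$ is the bijection recording the order of the $z$-coordinates of the strands at the multi-crossing, with $h(i)>h(j)$ exactly when strand $i$ lies above strand $j$ (has larger $z$-coordinate); i.e. $h(i)=k$ if strand $i$ is the $k$th strand counted from the lowest. Let $f(i,j)=i+j \pmod 2$. For $1\le i<j\le n$ define \[ \sigma(i,j)=\begin{cases} 1 & \text{if } h(i)>h(j) \text{ and } f(i,j)=0,\\ 1 & \text{if } h(i)<h(j) \text{ and } f(i,j)=1,\\ -1 & \text{if } h(i)>h(j) \text{ and } f(i,j)=1,\\ -1 & \text{if } h(i)<h(j) \text{ and } f(i,j)=0. \end{cases} \] *)

theory Defs
  imports "HOL-Analysis.Analysis"
begin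

section \<open>Legendrian knots\<close>

text \<open>A knot is given by a 1-periodic regular smooth parametrisation that is injective on a
  period; its parameter values modulo 1 are the points of the circle.\<close>

definition smooth_curve :: "(real \<Rightarrow> 'a::real_normed_vector) \<Rightarrow> bool" where
  "smooth_curve g \<longleftrightarrow>
     (\<forall>m t. ((\<lambda>f u. vector_derivative f (at u)) ^^ m) g differentiable (at t))"

definition knot :: "(real \<Rightarrow> real ^ 3) \<Rightarrow> bool" where
  "knot g \<longleftrightarrow> smooth_curve g \<and> (\<forall>t. g (t + 1) = g t) \<and> inj_on g {0..<1}
     \<and> (\<forall>t. vector_derivative g (at t) \<noteq> 0)"

definition xi_std :: "real ^ 3 \<Rightarrow> (real ^ 3) set" where
  "xi_std q = {v. v $ 3 - q $ 2 * v $ 1 = 0}"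

definition legendrian_knot :: "(real \<Rightarrow> real ^ 3) \<Rightarrow> bool" where
  "legendrian_knot g \<longleftrightarrow> knot g \<and> (\<forall>t. vector_derivative g (at t) \<in> xi_std (g t))"

text \<open>The \<open>xy\<close>-plane is identified with the complex plane.\<close>

definition lagr :: "(real \<Rightarrow> real ^ 3) \<Rightarrow> real \<Rightarrow> complex" where
  "lagr g t = Complex (g t $ 1) (g t $ 2)"

definition lagr_dir :: "(real \<Rightarrow> real ^ 3) \<Rightarrow> real \<Rightarrow> complex" where
  "lagr_dir g t = vector_derivative (lagr g) (at t)"


section \<open>Writhe and Thurston--Bennequin number\<close>

definition plane_det :: "complex \<Rightarrow> complex \<Rightarrow> real" where
  "plane_det u v = Re u * Im v - Im u * Re v"

text \<open>The crossing is viewed from the positive \<open>z\<close>-direction. It is positive (right-handed) if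
  the over-strand direction followed by the under-strand direction is a positively oriented basis
  of the plane; the value 0 occurs only for tangential strands.\<close>

definition crossing_sign :: "(real \<Rightarrow> real ^ 3) \<Rightarrow> real \<Rightarrow> real \<Rightarrow> int" where
  "crossing_sign g s t =
     (let d = (if g s $ 3 > g t $ 3 then plane_det (lagr_dir g s) (lagr_dir g t)
               else plane_det (lagr_dir g t) (lagr_dir g s))
      in if d > 0 then 1 else if d < 0 then -1 else 0)"

text \<open>One element for each unordered pair of strands that meet in the projection.\<close>

definition crossing_pairs :: "(real \<Rightarrow> real ^ 3) \<Rightarrow> (real \<times> real) set" where
  "crossing_pairs g = {(s, t). 0 \<le> s \<and> s < t \<and> t < 1 \<and> lagr g s = lagr g t}"

text \<open>Writhe of a projection with finitely many, possibly multiple, transverse crossings. Spreading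
  a multi-crossing makes any two of its strands cross exactly once, without changing their
  directions or which of them is the upper one. So every pair of strands through a common point
  contributes one double crossing, with the sign of that pair.\<close>

definition writhe :: "(real \<Rightarrow> real ^ 3) \<Rightarrow> int" where
  "writhe g = (\<Sum>(s, t)\<in>crossing_pairs g. crossing_sign g s t)"

definition tb :: "(real \<Rightarrow> real ^ 3) \<Rightarrow> int" where
  "tb g = writhe g"


section \<open>Petal projections with half-twists\<close>

definition strands :: "(real \<Rightarrow> real ^ 3) \<Rightarrow> complex \<Rightarrow> real set" where
  "strands g p = {t \<in> {0..<1}. lagr g t = p}"

definition multi_crossing :: "(real \<Rightarrow> real ^ 3) \<Rightarrow> complex \<Rightarrow> nat \<Rightarrow> bool" where
  "multi_crossing g p n \<longleftrightarrow> finite (strands g p) \<and> card (strands g p) = n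
     \<and> (\<forall>s\<in>strands g p. \<forall>t\<in>strands g p. s \<noteq> t
          \<longrightarrow> plane_det (lagr_dir g s) (lagr_dir g t) \<noteq> 0)"

text \<open>Below, \<open>R\<close> is the set of parameters of the part of the diagram left after some half-twists
  have been removed; initially it is a full period starting at a visit of the multi-crossing \<open>p\<close>.
  The loop of the remaining diagram that starts at the parameter \<open>a\<close> of a strand ends at the next
  visit of \<open>p\<close>; the end point is again \<open>p\<close>, so it need not be listed.\<close>

definition loop_at :: "(real \<Rightarrow> real ^ 3) \<Rightarrow> complex \<Rightarrow> real set \<Rightarrow> real \<Rightarrow> complex set" where
  "loop_at g p R a = lagr g ` {u \<in> R. a \<le> u \<and> (\<forall>w\<in>{a<..u}. lagr g w \<noteq> p)}"

definition no_other_crossing :: "(real \<Rightarrow> real ^ 3) \<Rightarrow> complex \<Rightarrow> real set \<Rightarrow> bool" where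
  "no_other_crossing g p R \<longleftrightarrow>
     (\<forall>u\<in>R. \<forall>v\<in>R. lagr g u = lagr g v \<longrightarrow> u = v \<or> lagr g u = p)"

definition no_nested_loops :: "(real \<Rightarrow> real ^ 3) \<Rightarrow> complex \<Rightarrow> real set \<Rightarrow> bool" where
  "no_nested_loops g p R \<longleftrightarrow>
     (\<forall>a\<in>R. \<forall>b\<in>R. lagr g a = p \<longrightarrow> lagr g b = p \<longrightarrow> a \<noteq> b
        \<longrightarrow> loop_at g p R a \<inter> inside (loop_at g p R b) = {})"

text \<open>A half-twist at the parameters \<open>s < t\<close>: a negative self-crossing of a petal which the
  first Reidemeister move removes. The arc from \<open>s\<close> to \<open>t\<close> is a closed curve without further
  crossings, and no part of the remaining diagram lies in the disc that it bounds.\<close>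

definition half_twist ::
    "(real \<Rightarrow> real ^ 3) \<Rightarrow> complex \<Rightarrow> real set \<Rightarrow> real \<Rightarrow> real \<Rightarrow> bool" where
  "half_twist g p R s t \<longleftrightarrow>
     s \<in> R \<and> t \<in> R \<and> s < t \<and> lagr g s = lagr g t \<and> p \<notin> lagr g ` {s..t}
     \<and> (\<forall>u\<in>R \<inter> {s..t}. \<forall>v\<in>R. lagr g u = lagr g v \<longrightarrow> u = v \<or> {u, v} = {s, t})
     \<and> inside (lagr g ` (R \<inter> {s..t})) \<inter> lagr g ` R = {}
     \<and> crossing_sign g s t = -1"

text \<open>\<open>twisted_petals g p R k\<close>: removing \<open>k\<close> half-twists one after the other turns the part \<open>R\<close> of
  the diagram into a petal projection. Removing the one at \<open>s < t\<close> cuts out the arc between \<open>s\<close> and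
  \<open>t\<close>; the rest stays closed because \<open>s\<close> and \<open>t\<close> have the same image, of which \<open>s\<close> is kept. Several
  half-twists on one petal are possible.\<close>

inductive twisted_petals ::
    "(real \<Rightarrow> real ^ 3) \<Rightarrow> complex \<Rightarrow> real set \<Rightarrow> nat \<Rightarrow> bool"
  for g :: "real \<Rightarrow> real ^ 3" and p :: complex where
  untwisted: "no_other_crossing g p R \<Longrightarrow> no_nested_loops g p R \<Longrightarrow> twisted_petals g p R 0"
| twist: "half_twist g p R s t \<Longrightarrow> twisted_petals g p (R - {s<..t}) k
            \<Longrightarrow> twisted_petals g p R (Suc k)"

definition lagrangian_petal_projection ::
    "(real \<Rightarrow> real ^ 3) \<Rightarrow> complex \<Rightarrow> nat \<Rightarrow> nat \<Rightarrow> bool" where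
  "lagrangian_petal_projection g p n k \<longleftrightarrow> odd n \<and> multi_crossing g p n
     \<and> (\<exists>t0. lagr g t0 = p \<and> twisted_petals g p {t0..<t0 + 1} k)"


section \<open>Labels, heights and signs\<close>

text \<open>Direction from the multi-crossing to the left end of a strand with direction \<open>v\<close>. For a
  vertical strand the upper end counts as the left one. Hence these directions have \<open>Arg2pi\<close> in
  \<open>[pi/2, 3pi/2)\<close>, and a larger value means a lower left end.\<close>

definition left_end :: "complex \<Rightarrow> complex" where
  "left_end v = (if Re v < 0 \<or> (Re v = 0 \<and> Im v > 0) then v else - v)"

definition strand_labelling ::
    "(real \<Rightarrow> real ^ 3) \<Rightarrow> complex \<Rightarrow> nat \<Rightarrow> (nat \<Rightarrow> real) \<Rightarrow> bool" where
  "strand_labelling g p n \<tau> \<longleftrightarrow> bij_betw \<tau> {1..n} (strands g p)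
     \<and> (\<forall>i\<in>{1..n}. \<forall>j\<in>{1..n}. i < j
          \<longrightarrow> Arg2pi (left_end (lagr_dir g (\<tau> i))) < Arg2pi (left_end (lagr_dir g (\<tau> j))))"

definition height_function ::
    "(real \<Rightarrow> real ^ 3) \<Rightarrow> nat \<Rightarrow> (nat \<Rightarrow> real) \<Rightarrow> (nat \<Rightarrow> nat) \<Rightarrow> bool" where
  "height_function g n \<tau> h \<longleftrightarrow> bij_betw h {1..n} {1..n}
     \<and> (\<forall>i\<in>{1..n}. \<forall>j\<in>{1..n}. h i > h j \<longleftrightarrow> g (\<tau> i) $ 3 > g (\<tau> j) $ 3)"

definition parity_sum :: "nat \<Rightarrow> nat \<Rightarrow> nat" where
  "parity_sum i j = (i + j) mod 2"

text \<open>The value 0 is a default for \<open>h i = h j\<close>, which does not occur for \<open>i < j\<close>.\<close>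

definition strand_sign :: "(nat \<Rightarrow> nat) \<Rightarrow> nat \<Rightarrow> nat \<Rightarrow> int" where
  "strand_sign h i j =
     (if h i > h j \<and> parity_sum i j = 0 then 1
      else if h i < h j \<and> parity_sum i j = 1 then 1
      else if h i > h j \<and> parity_sum i j = 1 then -1
      else if h i < h j \<and> parity_sum i j = 0 then -1
      else 0)"

end

theory Submission
  imports Defs
begin

text \<open>
  Half-twists and the multi-crossing contribute separately to the writhe. No strand of the diagram
  meets the small loop of a half-twist except at its own crossing, so removing a half-twist removes
  exactly one crossing, of sign \<open>-1\<close>; this gives the summand \<open>-k\<close>, and only the pairs of strands
  through the multi-crossing \<open>p\<close> are left (\<open>writhe_of_petals\<close>).

  The sign of such a pair depends on which strand is higher, which \<open>h\<close> records, and on whether the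
  two strands point to the same side. The sum over \<open>\<sigma>\<close> is therefore correct as soon as consecutive
  labels belong to strands with opposite orientations (\<open>strand_directions_alternate\<close>), and this is
  where the shape of the diagram matters. The \<open>n\<close> strands leave \<open>p\<close> along \<open>2n\<close> rays in cyclic order,
  and each petal goes out along one of them and returns along another. The two rays of a petal are
  neighbours: a petal is a Jordan curve, and near \<open>p\<close> one of the two sectors between its rays lies
  inside it (\<open>petal_fills_a_sector\<close>). If there were other rays in both sectors, one of them would
  belong to a petal that enters the inside of the first, against the absence of nested loops
  (\<open>no_rays_on_both_sides_of_petal\<close>). So the petals pair neighbouring rays, either
  all pairs \<open>{2m, 2m + 1}\<close> or all pairs \<open>{2m - 1, 2m}\<close>. Paired rays have opposite orientations, and so
  have opposite rays, which are \<open>n\<close> steps apart. As \<open>n\<close> is odd, of any two neighbouring rays either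
  they or the two opposite ones are paired; hence orientations alternate around \<open>p\<close>
  (\<open>rays_alternate\<close>).

  Two devices make this precise. To see that a petal from which half-twists were removed is still a
  Jordan curve, the remaining parameters are enumerated by a strictly increasing function that jumps
  over the removed arcs; composed with the projection it is continuous, since the two ends of a
  removed arc have the same image. The inside of a petal near \<open>p\<close> is analysed in polar coordinates:
  along a regular arc leaving \<open>p\<close> the distance from \<open>p\<close> increases, so every small circle
  around \<open>p\<close> meets it at most once, and a point of the inside close to the arc can be rotated into one
  of the two sectors without meeting the petal.
\<close>

section \<open>The Lagrangian projection of a smooth knot\<close>

lemma lagr_derivative:
  assumes "knot g"
  shows "(lagr g has_vector_derivative lagr_dir g t) (at t)" "isCont (lagr_dir g) t"
    "lagr g (t + 1) = lagr g t" "lagr_dir g (t + 1) = lagr_dir g t" "continuous_on UNIV (lagr g)"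
proof -
  define F where "F v = Complex (v $ 1) (v $ 2)" for v :: "real ^ 3"
  have F: "bounded_linear F"
    unfolding F_def Complex_eq
    by (intro bounded_linear_add bounded_linear_const_mult bounded_linear_compose[OF bounded_linear_of_real]
        bounded_linear_vec_nth)
  define g' where "g' u = vector_derivative g (at u)" for u
  have smooth: "((\<lambda>f u. vector_derivative f (at u)) ^^ m) g differentiable (at u)" for m u
    using assms by (simp add: knot_def smooth_curve_def)
  have per: "g (u + 1) = g u" for u using assms by (simp add: knot_def)
  have g: "(g has_vector_derivative g' u) (at u)" for u
    using smooth[of 0 u] by (simp add: vector_derivative_works g'_def)
  have g'_cont: "isCont g' u" for u
    using smooth[of 1 u] differentiable_imp_continuous_within by (fastforce simp: g'_def[abs_def])
  have lagr: "lagr g = F \<circ> g" by (auto simp: lagr_def F_def)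
  have d: "(lagr g has_vector_derivative F (g' u)) (at u)" for u
    unfolding lagr o_def by (rule bounded_linear.has_vector_derivative[OF F g])
  then have dir: "lagr_dir g = F \<circ> g'"
    by (auto simp: lagr_dir_def vector_derivative_at fun_eq_iff)
  show *: "(lagr g has_vector_derivative lagr_dir g t) (at t)" for t
    using d dir by simp
  show "isCont (lagr_dir g) t"
    unfolding dir o_def by (intro bounded_linear.isCont[OF F] g'_cont)
  show plus: "lagr g (t + 1) = lagr g t" for t using per by (simp add: lagr)
  show "continuous_on UNIV (lagr g)"
    using * by (meson continuous_at_imp_continuous_on has_vector_derivative_continuous)
  have "((\<lambda>u. u + 1) has_vector_derivative 1) (at t)"
    by (auto intro!: derivative_eq_intros)
  from vector_diff_chain_at[OF this, of "lagr g" "lagr_dir g (t + 1)"] *[of "t + 1"]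
  have "(lagr g has_vector_derivative lagr_dir g (t + 1)) (at t)"
    by (simp add: o_def plus)
  then show "lagr_dir g (t + 1) = lagr_dir g t"
    using *[of t] vector_derivative_unique_at by blast
qed

section \<open>Writhe of a twisted petal projection\<close>

text \<open>Every crossing occurs twice, once for each order of its strands. Unlike \<open>crossing_pairs\<close>, this
  set does not depend on where the parameter circle is cut.\<close>

definition ordered_crossings :: "(real \<Rightarrow> real ^ 3) \<Rightarrow> real set \<Rightarrow> (real \<times> real) set" where
  "ordered_crossings g R = {(s, t). s \<in> R \<and> t \<in> R \<and> s \<noteq> t \<and> lagr g s = lagr g t}"

lemma sum_symmetric_pairs:
  fixes f :: "'a :: linorder \<Rightarrow> 'a \<Rightarrow> int"
  assumes "finite {(x, y). Q x y \<and> x \<noteq> y}" "\<And>x y. Q x y \<Longrightarrow> Q y x"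
    "\<And>x y. Q x y \<Longrightarrow> x \<noteq> y \<Longrightarrow> f x y = f y x"
  shows "(\<Sum>(x, y)\<in>{(x, y). Q x y \<and> x \<noteq> y}. f x y) = 2 * (\<Sum>(x, y)\<in>{(x, y). Q x y \<and> x < y}. f x y)"
proof -
  let ?L = "{(x, y). Q x y \<and> x < y}" and ?G = "{(x, y). Q x y \<and> y < x}"
  have split: "{(x, y). Q x y \<and> x \<noteq> y} = ?L \<union> ?G" by auto
  then have fin: "finite ?L" "finite ?G" using assms(1) by auto
  have G: "?G = prod.swap ` ?L" using assms(2) by force
  have "(\<Sum>(x, y)\<in>{(x, y). Q x y \<and> x \<noteq> y}. f x y) = (\<Sum>(x, y)\<in>?L. f x y) + (\<Sum>(x, y)\<in>?G. f x y)"
    unfolding split by (rule sum.union_disjoint) (use fin in auto)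
  also have "(\<Sum>(x, y)\<in>?G. f x y) = (\<Sum>(x, y)\<in>?L. f x y)"
  proof -
    have "(\<Sum>(x, y)\<in>?G. f x y) = (\<Sum>(x, y)\<in>?L. f y x)"
      unfolding G by (subst sum.reindex) (auto intro!: sum.cong)
    also have "\<dots> = (\<Sum>(x, y)\<in>?L. f x y)"
      by (intro sum.cong refl) (use assms(3) in force)
    finally show ?thesis .
  qed
  finally show ?thesis by simp
qed

lemma crossing_sign_commute:
  "g s $ 3 \<noteq> g t $ 3 \<Longrightarrow> crossing_sign g s t = crossing_sign g t s"
  by (auto simp: crossing_sign_def)

text \<open>The removed arc takes part in one crossing only, the one of the half-twist itself, and that one
  is counted in both orders.\<close>

lemma twisted_petals_crossings:
  assumes "twisted_petals g p R k"
    and "\<And>s t. (s, t) \<in> ordered_crossings g R \<Longrightarrow> g s $ 3 \<noteq> g t $ 3"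
    and "finite {u \<in> R. lagr g u = p}"
  shows "finite (ordered_crossings g R) \<and> (\<Sum>(s, t)\<in>ordered_crossings g R. crossing_sign g s t)
     = - 2 * int k + (\<Sum>(s, t)\<in>ordered_crossings g {u \<in> R. lagr g u = p}. crossing_sign g s t)"
  using assms
proof (induction)
  case (untwisted R)
  then have "ordered_crossings g R = ordered_crossings g {u \<in> R. lagr g u = p}"
    by (fastforce simp: ordered_crossings_def no_other_crossing_def)
  moreover have "finite (ordered_crossings g {u \<in> R. lagr g u = p})"
    by (rule finite_subset[of _ "{u \<in> R. lagr g u = p} \<times> {u \<in> R. lagr g u = p}"])
      (use untwisted in \<open>auto simp: ordered_crossings_def\<close>)
  ultimately show ?case by simp
next
  case (twist R s t k)
  have st: "s \<in> R" "t \<in> R" "s < t" "lagr g s = lagr g t" "p \<notin> lagr g ` {s..t}"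
    "crossing_sign g s t = -1"
    and only: "\<And>u v. u \<in> R \<Longrightarrow> s \<le> u \<Longrightarrow> u \<le> t \<Longrightarrow> v \<in> R \<Longrightarrow> lagr g u = lagr g v \<Longrightarrow> u = v \<or> {u, v} = {s, t}"
    using twist.hyps(1) by (auto simp: half_twist_def)
  define R' where "R' = R - {s<..t}"
  have mult: "{u \<in> R'. lagr g u = p} = {u \<in> R. lagr g u = p}"
    using st(5) by (force simp: R'_def)
  have IH: "finite (ordered_crossings g R')" "(\<Sum>(s, t)\<in>ordered_crossings g R'. crossing_sign g s t)
     = - 2 * int k + (\<Sum>(s, t)\<in>ordered_crossings g {u \<in> R. lagr g u = p}. crossing_sign g s t)"
    using twist.IH twist.prems unfolding R'_def[symmetric] mult
    by (auto simp: ordered_crossings_def R'_def)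
  have split: "ordered_crossings g R = {(s, t), (t, s)} \<union> ordered_crossings g R'"
  proof (intro equalityI subrelI)
    fix u v assume uv: "(u, v) \<in> ordered_crossings g R"
    then have uvR: "u \<in> R" "v \<in> R" "lagr g u = lagr g v" "u \<noteq> v" by (auto simp: ordered_crossings_def)
    show "(u, v) \<in> {(s, t), (t, s)} \<union> ordered_crossings g R'"
    proof (cases "u \<in> R' \<and> v \<in> R'")
      case True
      then show ?thesis using uvR by (auto simp: ordered_crossings_def)
    next
      case False
      then have "u \<in> {s..t} \<or> v \<in> {s..t}" using uvR by (auto simp: R'_def)
      then have "{u, v} = {s, t} \<or> {v, u} = {s, t}"
        using only[of u v] only[of v u] uvR by auto
      then show ?thesis using uvR by (auto simp: doubleton_eq_iff)
    qed
  qed (use st in \<open>auto simp: ordered_crossings_def R'_def\<close>)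
  have "crossing_sign g t s = -1"
    using crossing_sign_commute[of g s t] twist.prems(1)[of s t] st by (auto simp: ordered_crossings_def)
  moreover have "t \<notin> R'" using st by (auto simp: R'_def)
  ultimately show ?case
    unfolding split using IH st by (auto simp: ordered_crossings_def sum.insert_if)
qed

lemma periodic_int:
  fixes f :: "real \<Rightarrow> 'a"
  assumes "\<And>t. f (t + 1) = f t"
  shows "f (t + of_int m) = f t"
proof -
  have nat: "f (t + real k) = f t" for t k
  proof (induction k)
    case (Suc k)
    have "t + real (Suc k) = t + real k + 1" by simp
    then show ?case using Suc assms by metis
  qed simp
  show ?thesis
    using nat[of t "nat m"] nat[of "t + of_int m" "nat (- m)"] by (cases "m \<ge> 0") auto
qed

text \<open>The representative modulo 1 of \<open>t\<close> in the period that starts at \<open>t\<^sub>0\<close>.\<close>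

definition into_period :: "real \<Rightarrow> real \<Rightarrow> real" where
  "into_period t\<^sub>0 t = t\<^sub>0 + frac (t - t\<^sub>0)"

lemma into_period_periodic:
  fixes f :: "real \<Rightarrow> 'a"
  assumes "\<And>t. f (t + 1) = f t"
  shows "f (into_period t\<^sub>0 t) = f t"
proof -
  have "into_period t\<^sub>0 t = t + of_int (- \<lfloor>t - t\<^sub>0\<rfloor>)" by (simp add: into_period_def frac_def)
  then show ?thesis using periodic_int[of f, OF assms] by metis
qed

lemma bij_betw_into_period: "bij_betw (into_period t\<^sub>0) {0..<1} {t\<^sub>0..<t\<^sub>0 + 1}"
proof (rule bij_betw_byWitness[where f' = frac])
  show "\<forall>t\<in>{0..<1}. frac (into_period t\<^sub>0 t) = t"
  proof
    fix t :: real assume "t \<in> {0..<1}"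
    then show "frac (into_period t\<^sub>0 t) = t"
      by (subst frac_unique_iff) (auto simp: into_period_def frac_def)
  qed
  show "\<forall>t\<in>{t\<^sub>0..<t\<^sub>0 + 1}. into_period t\<^sub>0 (frac t) = t"
  proof
    fix t assume "t \<in> {t\<^sub>0..<t\<^sub>0 + 1}"
    then have "frac (frac t - t\<^sub>0) = t - t\<^sub>0"
      by (subst frac_unique_iff) (auto simp: frac_def)
    then show "into_period t\<^sub>0 (frac t) = t" by (simp add: into_period_def)
  qed
qed (auto simp: into_period_def frac_lt_1)

lemma crossings_into_period:
  assumes "knot g" "S \<subseteq> {0..<1}"
  shows "ordered_crossings g (into_period t\<^sub>0 ` S) = map_prod (into_period t\<^sub>0) (into_period t\<^sub>0) ` ordered_crossings g S"
    and "inj_on (map_prod (into_period t\<^sub>0) (into_period t\<^sub>0)) (ordered_crossings g S)"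
    and "(\<Sum>(s, t)\<in>ordered_crossings g (into_period t\<^sub>0 ` S). crossing_sign g s t)
     = (\<Sum>(s, t)\<in>ordered_crossings g S. crossing_sign g s t)"
proof -
  let ?w = "into_period t\<^sub>0"
  have inj: "inj_on ?w S" by (rule inj_on_subset[OF bij_betw_imp_inj_on[OF bij_betw_into_period] assms(2)])
  note lagr = into_period_periodic[of "lagr g" t\<^sub>0, OF lagr_derivative(3)[OF assms(1)]]
  note dir = into_period_periodic[of "lagr_dir g" t\<^sub>0, OF lagr_derivative(4)[OF assms(1)]]
  have per: "g (?w t) = g t" for t
    using into_period_periodic[of g] assms(1) by (auto simp: knot_def)
  show 1: "ordered_crossings g (?w ` S) = map_prod ?w ?w ` ordered_crossings g S"
  proof (intro equalityI subrelI)
    fix x y assume *: "(x, y) \<in> ordered_crossings g (?w ` S)"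
    then obtain s t where st: "s \<in> S" "t \<in> S" "x = ?w s" "y = ?w t"
      by (auto simp: ordered_crossings_def)
    with * have "(s, t) \<in> ordered_crossings g S"
      by (auto simp: ordered_crossings_def lagr)
    with st show "(x, y) \<in> map_prod ?w ?w ` ordered_crossings g S"
      by (intro image_eqI[of _ _ "(s, t)"]) auto
  next
    fix x y assume "(x, y) \<in> map_prod ?w ?w ` ordered_crossings g S"
    then obtain s t where "s \<in> S" "t \<in> S" "x = ?w s" "y = ?w t" "s \<noteq> t" "lagr g s = lagr g t"
      by (auto simp: ordered_crossings_def)
    then show "(x, y) \<in> ordered_crossings g (?w ` S)"
      using inj_onD[OF inj, of s t] by (auto simp: ordered_crossings_def lagr)
  qed
  show 2: "inj_on (map_prod ?w ?w) (ordered_crossings g S)"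
    using inj by (auto simp: inj_on_def ordered_crossings_def)
  show "(\<Sum>(s, t)\<in>ordered_crossings g (?w ` S). crossing_sign g s t)
     = (\<Sum>(s, t)\<in>ordered_crossings g S. crossing_sign g s t)"
    unfolding 1 sum.reindex[OF 2]
    by (intro sum.cong) (auto simp: crossing_sign_def dir per)
qed

text \<open>The writhe is defined on the period \<open>[0, 1)\<close>, the half-twists are removed from the period that
  starts at a visit of \<open>p\<close>. Ordered pairs can be moved from one to the other, which accounts for the
  factor 2.\<close>

lemma writhe_of_petals:
  assumes g: "knot g" and "finite (strands g p)" and tw: "twisted_petals g p {t\<^sub>0..<t\<^sub>0 + 1} k"
  shows "2 * writhe g = - 2 * int k + (\<Sum>(s, t)\<in>ordered_crossings g (strands g p). crossing_sign g s t)"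
proof -
  let ?w = "into_period t\<^sub>0"
  have w: "?w ` {0..<1} = {t\<^sub>0..<t\<^sub>0 + 1}"
    using bij_betw_into_period by (rule bij_betw_imp_surj_on)
  note lagr = into_period_periodic[of "lagr g" t\<^sub>0, OF lagr_derivative(3)[OF g]]
  have per: "g (?w t) = g t" for t
    using into_period_periodic[of g] g by (auto simp: knot_def)
  have w': "?w ` strands g p = {u \<in> {t\<^sub>0..<t\<^sub>0 + 1}. lagr g u = p}"
    unfolding w[symmetric] by (auto simp: strands_def lagr)
  have height: "g s $ 3 \<noteq> g t $ 3" if "(s, t) \<in> ordered_crossings g {0..<1}" for s t
  proof
    assume "g s $ 3 = g t $ 3"
    moreover have "g s $ 1 = g t $ 1" "g s $ 2 = g t $ 2"
      using that by (auto simp: ordered_crossings_def lagr_def)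
    ultimately have "g s = g t" by (simp add: vec_eq_iff forall_3)
    then show False using that g by (auto simp: ordered_crossings_def knot_def inj_on_def)
  qed
  have height': "g s $ 3 \<noteq> g t $ 3" if "(s, t) \<in> ordered_crossings g {t\<^sub>0..<t\<^sub>0 + 1}" for s t
    using that height unfolding w[symmetric] crossings_into_period(1)[OF g order_refl] by (auto simp: per)
  have "finite {u \<in> {t\<^sub>0..<t\<^sub>0 + 1}. lagr g u = p}"
    unfolding w'[symmetric] using assms(2) by simp
  note main = twisted_petals_crossings[OF tw height' this]
  have fin: "finite (ordered_crossings g {0..<1})"
    using main crossings_into_period(1,2)[OF g order_refl, of t\<^sub>0] unfolding w
    by (metis finite_imageD)
  have cp: "ordered_crossings g {0..<1} = {(s, t). (s \<in> {0..<1} \<and> t \<in> {0..<1} \<and> lagr g s = lagr g t) \<and> s \<noteq> t}"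
    by (auto simp: ordered_crossings_def)
  have "(\<Sum>(s, t)\<in>ordered_crossings g {0..<1}. crossing_sign g s t)
      = 2 * (\<Sum>(s, t)\<in>{(s, t). (s \<in> {0..<1} \<and> t \<in> {0..<1} \<and> lagr g s = lagr g t) \<and> s < t}. crossing_sign g s t)"
    unfolding cp
  proof (rule sum_symmetric_pairs)
    show "crossing_sign g s t = crossing_sign g t s"
      if "s \<in> {0..<1} \<and> t \<in> {0..<1} \<and> lagr g s = lagr g t" "s \<noteq> t" for s t
      using that height by (intro crossing_sign_commute) (auto simp: ordered_crossings_def)
  qed (use fin cp in auto)
  also have "{(s, t). (s \<in> {0..<1} \<and> t \<in> {0..<1} \<and> lagr g s = lagr g t) \<and> s < t} = crossing_pairs g"
    by (auto simp: crossing_pairs_def)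
  finally have "2 * writhe g = (\<Sum>(s, t)\<in>ordered_crossings g {t\<^sub>0..<t\<^sub>0 + 1}. crossing_sign g s t)"
    unfolding w[symmetric] crossings_into_period(3)[OF g order_refl] by (simp add: writhe_def)
  also have "\<dots> = - 2 * int k + (\<Sum>(s, t)\<in>ordered_crossings g (?w ` strands g p). crossing_sign g s t)"
    using main w' by simp
  also have "(\<Sum>(s, t)\<in>ordered_crossings g (?w ` strands g p). crossing_sign g s t)
      = (\<Sum>(s, t)\<in>ordered_crossings g (strands g p). crossing_sign g s t)"
    by (rule crossings_into_period(3)[OF g]) (auto simp: strands_def)
  finally show ?thesis .
qed

section \<open>Polar coordinates around the multi-crossing\<close>

text \<open>The points seen from \<open>p\<close> within angle \<open>\<eta>\<close> of the direction \<open>\<alpha>\<close>. The inner-product form is an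
  open condition and needs no branch of the argument.\<close>

definition angular_cone :: "complex \<Rightarrow> real \<Rightarrow> real \<Rightarrow> complex set" where
  "angular_cone p \<alpha> \<eta> = {z. cos \<eta> * cmod (z - p) < Re ((z - p) * cis (- \<alpha>))}"

lemma polar_in_angular_cone_iff:
  assumes "0 \<le> r"
  shows "p + of_real r * cis \<gamma> \<in> angular_cone p \<alpha> \<eta> \<longleftrightarrow> 0 < r \<and> cos \<eta> < cos (\<gamma> - \<alpha>)"
proof -
  have "Re (of_real r * cis \<gamma> * cis (- \<alpha>)) = r * cos (\<gamma> - \<alpha>)"
    by (simp add: mult.assoc cis_mult del: cis.simps(2))
  then show ?thesis
    using assms by (cases "r = 0") (auto simp: angular_cone_def norm_mult mult.commute)
qed

lemma angular_cone_polar: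
  assumes "z \<in> angular_cone p \<alpha> \<eta>" "0 < \<eta>" "\<eta> < pi"
  obtains \<gamma> where "\<bar>\<gamma> - \<alpha>\<bar> < \<eta>" "z = p + of_real (cmod (z - p)) * cis \<gamma>" "z \<noteq> p"
proof -
  define w where "w = (z - p) * cis (- \<alpha>)"
  define \<theta> where "\<theta> = Arg w"
  have zp: "z \<noteq> p" using assms(1) by (auto simp: angular_cone_def)
  have nw: "cmod w = cmod (z - p)" by (simp add: w_def norm_mult)
  have "w \<noteq> 0" using zp nw by auto
  then have w: "w = of_real (cmod w) * cis \<theta>"
    unfolding \<theta>_def using rcis_cmod_Arg[of w] by (simp add: rcis_def)
  have z: "z = p + of_real (cmod (z - p)) * cis (\<theta> + \<alpha>)"
  proof -
    have "of_real (cmod (z - p)) * cis (\<theta> + \<alpha>) = w * cis \<alpha>"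
      by (subst w) (simp add: nw cis_mult mult.assoc)
    also have "\<dots> = z - p" by (simp add: w_def mult.assoc cis_mult)
    finally show ?thesis by simp
  qed
  have "p + of_real (cmod (z - p)) * cis (\<theta> + \<alpha>) \<in> angular_cone p \<alpha> \<eta>" using z assms(1) by simp
  then have "cos \<eta> < cos \<theta>" by (subst (asm) polar_in_angular_cone_iff) auto
  moreover have "- pi < \<theta>" "\<theta> \<le> pi" using Arg_bounded[of w] by (auto simp: \<theta>_def)
  ultimately have "\<bar>\<theta>\<bar> < \<eta>"
    using cos_mono_less_eq[of \<eta> "\<bar>\<theta>\<bar>"] assms(2,3) by (simp add: abs_le_iff)
  then show thesis using that[of "\<theta> + \<alpha>"] z zp by auto
qed

lemma open_angular_cone: "open (angular_cone p \<alpha> \<eta>)"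
  unfolding angular_cone_def by (intro open_Collect_less continuous_intros)

lemma polar_unique:
  assumes "p + of_real r * cis \<gamma> = p + of_real r' * cis \<gamma>'" "0 < r" "0 < r'"
    "\<bar>\<gamma> - \<gamma>'\<bar> < 2 * pi"
  shows "\<gamma> = \<gamma>'"
proof -
  have eq: "of_real r * cis \<gamma> = of_real r' * cis \<gamma>'" using assms(1) by simp
  then have "cmod (of_real r * cis \<gamma>) = cmod (of_real r' * cis \<gamma>')" by simp
  then have "r = r'" using assms by (simp add: norm_mult)
  with eq assms have "cis \<gamma> = cis \<gamma>'" by simp
  then have "cis (\<gamma> - \<gamma>') = 1" by (metis cis_divide cis_neq_zero divide_self)
  then have "cos (\<gamma> - \<gamma>') = 1" by (metis cis.simps(1) one_complex.simps(1))
  then obtain n :: int where n: "\<gamma> - \<gamma>' = of_int n * 2 * pi" using cos_one_2pi_int by blast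
  then have "\<bar>of_int n :: real\<bar> * (2 * pi) < 1 * (2 * pi)" using assms(4)
    by (simp add: abs_mult)
  then have "\<bar>of_int n :: real\<bar> < 1" by (subst (asm) mult_less_cancel_right_pos) auto
  then have "n = 0" by linarith
  then show ?thesis using n by simp
qed

lemma cis_add_2pi: "cis (a + 2 * pi) = cis a" "cis (a - 2 * pi) = cis a"
  by (simp_all add: complex_eq_iff cos_diff sin_diff)

text \<open>The inside of a set is a union of components of its complement.\<close>

lemma connected_subset_inside:
  assumes "connected T" "T \<inter> L = {}" "x \<in> T" "x \<in> inside L"
  shows "T \<subseteq> inside L"
proof
  fix y assume "y \<in> T"
  then have "connected_component (- L) x y"
    using assms by (auto simp: connected_component_def)
  then show "y \<in> inside L" using assms(4) inside_same_component by blast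
qed

text \<open>Angles are real numbers, not reduced modulo \<open>2\<pi>\<close>, so that the two sectors between two
  directions are described in the same way.\<close>

definition sector :: "complex \<Rightarrow> real \<Rightarrow> real \<Rightarrow> real \<Rightarrow> complex set" where
  "sector p \<rho> \<gamma>\<^sub>1 \<gamma>\<^sub>2 = (\<lambda>(r, \<gamma>). p + of_real r * cis \<gamma>) ` ({0<..<\<rho>} \<times> {\<gamma>\<^sub>1..\<gamma>\<^sub>2})"

lemma connected_sector: "connected (sector p \<rho> \<gamma>\<^sub>1 \<gamma>\<^sub>2)"
  unfolding sector_def
  by (intro connected_continuous_image connected_Times)
    (auto simp: case_prod_unfold intro!: continuous_intros)

lemma circular_arc_inside:
  assumes "0 < r" "p + of_real r * cis \<gamma> \<in> inside L" "\<gamma> \<in> {\<gamma>\<^sub>1..\<gamma>\<^sub>2}" "\<gamma>' \<in> {\<gamma>\<^sub>1..\<gamma>\<^sub>2}"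
    and "\<And>\<delta>. \<gamma>\<^sub>1 \<le> \<delta> \<Longrightarrow> \<delta> \<le> \<gamma>\<^sub>2 \<Longrightarrow> p + of_real r * cis \<delta> \<notin> L"
  shows "p + of_real r * cis \<gamma>' \<in> inside L"
proof -
  let ?T = "(\<lambda>\<delta>. p + of_real r * cis \<delta>) ` {\<gamma>\<^sub>1..\<gamma>\<^sub>2}"
  have "connected ?T"
    by (intro connected_continuous_image continuous_intros) auto
  then have "?T \<subseteq> inside L"
    using assms by (intro connected_subset_inside[where x = "p + of_real r * cis \<gamma>"]) auto
  then show ?thesis using assms(4) by blast
qed

text \<open>Let a closed curve \<open>L\<close> have, near \<open>p\<close>, one branch in direction \<open>\<alpha>\<close> and one in direction
  \<open>\<beta>\<close>, and let the first branch meet each small circle around \<open>p\<close> at most once. Near a point \<open>q\<close> of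
  that branch there are points of the inside. Rotating such a point around \<open>p\<close>, away from the one
  point of the branch with the same distance from \<open>p\<close>, leads into one of the two sectors without
  crossing \<open>L\<close>; that sector is connected and disjoint from \<open>L\<close>, hence inside.\<close>

lemma jordan_curve_fills_a_sector:
  assumes small: "0 < \<rho>" "0 < \<eta>" "\<alpha> + 2 * \<eta> < \<beta>" "\<beta> + 2 * \<eta> < \<alpha> + 2 * pi"
    and near: "\<And>z. z \<in> L \<Longrightarrow> z \<noteq> p \<Longrightarrow> cmod (z - p) < \<rho> \<Longrightarrow> z \<in> angular_cone p \<alpha> \<eta> \<or> z \<in> angular_cone p \<beta> \<eta>"
    and uniq: "\<And>z z'. z \<in> L \<Longrightarrow> z' \<in> L \<Longrightarrow> z \<in> angular_cone p \<alpha> \<eta> \<Longrightarrow> z' \<in> angular_cone p \<alpha> \<eta>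
          \<Longrightarrow> cmod (z - p) < \<rho> \<Longrightarrow> cmod (z' - p) = cmod (z - p) \<Longrightarrow> z = z'"
    and q: "q \<in> angular_cone p \<alpha> \<eta>" "cmod (q - p) < \<rho>" "q \<in> closure (inside L)"
  shows "sector p \<rho> (\<alpha> + \<eta>) (\<beta> - \<eta>) \<subseteq> inside L
       \<or> sector p \<rho> (\<beta> + \<eta>) (\<alpha> + 2 * pi - \<eta>) \<subseteq> inside L"
proof -
  have eta: "\<eta> < pi" using small by simp
  define U where "U = angular_cone p \<alpha> \<eta> \<inter> ball p \<rho>"
  have "open U" "q \<in> U"
    using q open_angular_cone by (auto simp: U_def dist_norm norm_minus_commute)
  then obtain z where z: "z \<in> U" "z \<in> inside L"
    using q(3) by (metis IntD1 IntD2 all_not_in_conv open_Int_closure_eq_empty disjoint_iff)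
  obtain \<gamma> where \<gamma>: "\<bar>\<gamma> - \<alpha>\<bar> < \<eta>" "z = p + of_real (cmod (z - p)) * cis \<gamma>" "z \<noteq> p"
    using z eta small by (auto simp: U_def elim: angular_cone_polar)
  define r where "r = cmod (z - p)"
  have r: "0 < r" "r < \<rho>" using \<gamma> z by (auto simp: r_def U_def dist_norm norm_minus_commute)
  have zr: "p + of_real r * cis \<gamma> \<in> inside L" using \<gamma>(2) z r_def by simp
  have hit: "\<exists>\<gamma>'. (\<bar>\<gamma>' - \<alpha>\<bar> < \<eta> \<and> p + of_real s * cis \<delta> \<in> angular_cone p \<alpha> \<eta> \<or> \<bar>\<gamma>' - \<beta>\<bar> < \<eta>)
      \<and> p + of_real s * cis \<delta> = p + of_real s * cis \<gamma>'"
    if L: "p + of_real s * cis \<delta> \<in> L" and s: "0 < s" "s < \<rho>" for s \<delta>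
  proof -
    let ?z = "p + of_real s * cis \<delta>"
    have "cmod (?z - p) = s" using s by (simp add: norm_mult)
    with near[OF L] s have "?z \<in> angular_cone p \<alpha> \<eta> \<or> ?z \<in> angular_cone p \<beta> \<eta>" by force
    then show ?thesis
    proof
      assume *: "?z \<in> angular_cone p \<alpha> \<eta>"
      from angular_cone_polar[OF this \<open>0 < \<eta>\<close> eta] show ?thesis
        using * \<open>cmod (?z - p) = s\<close> by metis
    next
      assume "?z \<in> angular_cone p \<beta> \<eta>"
      from angular_cone_polar[OF this \<open>0 < \<eta>\<close> eta] show ?thesis
        using \<open>cmod (?z - p) = s\<close> by metis
    qed
  qed
  have free: "sector p \<rho> \<gamma>\<^sub>1 \<gamma>\<^sub>2 \<inter> L = {}"
    if "\<And>s \<delta>. \<gamma>\<^sub>1 \<le> \<delta> \<Longrightarrow> \<delta> \<le> \<gamma>\<^sub>2 \<Longrightarrow> 0 < s \<Longrightarrow> s < \<rho> \<Longrightarrow> p + of_real s * cis \<delta> \<notin> L" for \<gamma>\<^sub>1 \<gamma>\<^sub>2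
    using that by (fastforce simp: sector_def)
  have free1: "sector p \<rho> (\<alpha> + \<eta>) (\<beta> - \<eta>) \<inter> L = {}" 
  proof (rule free)
    fix s \<delta> assume *: "\<alpha> + \<eta> \<le> \<delta>" "\<delta> \<le> \<beta> - \<eta>" "0 < s" "s < \<rho>"
    show "p + of_real s * cis \<delta> \<notin> L"
    proof
      assume "p + of_real s * cis \<delta> \<in> L"
      then obtain \<gamma>' where 1: "\<bar>\<gamma>' - \<alpha>\<bar> < \<eta> \<or> \<bar>\<gamma>' - \<beta>\<bar> < \<eta>"
        and 2: "p + of_real s * cis \<delta> = p + of_real s * cis \<gamma>'"
        using hit * by blast
      have "\<bar>\<delta> - \<gamma>'\<bar> < 2 * pi" using 1 * small by linarith
      then have "\<delta> = \<gamma>'" using polar_unique[OF 2] * by blast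
      then show False using 1 * small by linarith
    qed
  qed
  have free2: "sector p \<rho> (\<beta> + \<eta>) (\<alpha> + 2 * pi - \<eta>) \<inter> L = {}"
  proof (rule free)
    fix s \<delta> assume *: "\<beta> + \<eta> \<le> \<delta>" "\<delta> \<le> \<alpha> + 2 * pi - \<eta>" "0 < s" "s < \<rho>"
    show "p + of_real s * cis \<delta> \<notin> L"
    proof
      assume "p + of_real s * cis \<delta> \<in> L"
      then obtain \<gamma>' where 1: "\<bar>\<gamma>' - \<alpha>\<bar> < \<eta> \<or> \<bar>\<gamma>' - \<beta>\<bar> < \<eta>"
        and 2: "p + of_real s * cis \<delta> = p + of_real s * cis \<gamma>'"
        using hit * by blast
      \<comment> \<open>Move the angle next to \<open>\<alpha>\<close> by a full turn, to the upper end of the second sector.\<close>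
      define \<gamma>'' where "\<gamma>'' = (if \<bar>\<gamma>' - \<alpha>\<bar> < \<eta> then \<gamma>' + 2 * pi else \<gamma>')"
      have 3: "p + of_real s * cis \<delta> = p + of_real s * cis \<gamma>''"
        using 2 by (simp add: \<gamma>''_def cis_add_2pi)
      have 4: "\<bar>\<gamma>'' - (\<alpha> + 2 * pi)\<bar> < \<eta> \<or> \<bar>\<gamma>'' - \<beta>\<bar> < \<eta>"
        using 1 by (auto simp: \<gamma>''_def)
      have "\<bar>\<delta> - \<gamma>''\<bar> < 2 * pi" using 4 * small by linarith
      then have "\<delta> = \<gamma>''" using polar_unique[OF 3] * by blast
      then show False using 4 * small by linarith
    qed
  qed
  \<comment> \<open>Rotate the inside point counterclockwise to the first sector if \<open>L\<close> permits it, otherwise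
    clockwise to the second; a circle meets the branch near \<open>\<alpha>\<close> only once, so \<open>L\<close> cannot block both.\<close>
  show ?thesis
  proof (cases "\<exists>\<delta>\<in>{\<gamma>..\<beta> - \<eta>}. p + of_real r * cis \<delta> \<in> L")
    case False
    have "p + of_real r * cis (\<beta> - \<eta>) \<in> inside L"
    proof (rule circular_arc_inside[OF r(1) zr])
      show "\<gamma> \<in> {\<gamma>..\<beta> - \<eta>}" "\<beta> - \<eta> \<in> {\<gamma>..\<beta> - \<eta>}" using \<gamma>(1) small by auto
    qed (use False in auto)
    moreover have "p + of_real r * cis (\<beta> - \<eta>) \<in> sector p \<rho> (\<alpha> + \<eta>) (\<beta> - \<eta>)"
      using r small by (force simp: sector_def)
    ultimately show ?thesis
      using connected_subset_inside[OF connected_sector free1] by blast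
  next
    case True
    then obtain \<delta>\<^sub>1 where d1: "\<gamma> \<le> \<delta>\<^sub>1" "\<delta>\<^sub>1 \<le> \<beta> - \<eta>" "p + of_real r * cis \<delta>\<^sub>1 \<in> L" by auto
    have c1: "p + of_real r * cis \<delta>\<^sub>1 \<in> angular_cone p \<alpha> \<eta>"
    proof -
      obtain \<gamma>' where 1: "\<bar>\<gamma>' - \<alpha>\<bar> < \<eta> \<and> p + of_real r * cis \<delta>\<^sub>1 \<in> angular_cone p \<alpha> \<eta> \<or> \<bar>\<gamma>' - \<beta>\<bar> < \<eta>"
        and 2: "p + of_real r * cis \<delta>\<^sub>1 = p + of_real r * cis \<gamma>'"
        using hit d1 r by blast
      have False if "\<bar>\<gamma>' - \<beta>\<bar> < \<eta>"
      proof -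
        have "\<bar>\<delta>\<^sub>1 - \<gamma>'\<bar> < 2 * pi" using that d1 \<gamma>(1) small by linarith
        then have "\<delta>\<^sub>1 = \<gamma>'" using polar_unique[OF 2] r by blast
        then show False using that d1 by linarith
      qed
      then show ?thesis using 1 by blast
    qed
    have free: "p + of_real r * cis \<delta> \<notin> L" if d: "\<beta> + \<eta> - 2 * pi \<le> \<delta>" "\<delta> \<le> \<gamma>" for \<delta>
    proof
      assume L: "p + of_real r * cis \<delta> \<in> L"
      obtain \<gamma>' where 1: "\<bar>\<gamma>' - \<alpha>\<bar> < \<eta> \<and> p + of_real r * cis \<delta> \<in> angular_cone p \<alpha> \<eta> \<or> \<bar>\<gamma>' - \<beta>\<bar> < \<eta>"
        and 2: "p + of_real r * cis \<delta> = p + of_real r * cis \<gamma>'"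
        using hit L r by blast
      have False if "\<bar>\<gamma>' - \<beta>\<bar> < \<eta>"
      proof -
        have 3: "p + of_real r * cis \<delta> = p + of_real r * cis (\<gamma>' - 2 * pi)"
          using 2 by (simp add: cis_add_2pi)
        have "\<bar>\<delta> - (\<gamma>' - 2 * pi)\<bar> < 2 * pi" using that d \<gamma>(1) small by linarith
        then have "\<delta> = \<gamma>' - 2 * pi" using polar_unique[OF 3] r by blast
        then show False using that d by linarith
      qed
      then have c: "p + of_real r * cis \<delta> \<in> angular_cone p \<alpha> \<eta>" using 1 by blast
      have "p + of_real r * cis \<delta> = p + of_real r * cis \<delta>\<^sub>1"
        using r by (intro uniq[OF L d1(3) c c1]) (auto simp: norm_mult)
      moreover have "\<bar>\<delta> - \<delta>\<^sub>1\<bar> < 2 * pi" using d d1 small \<gamma>(1) by linarith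
      ultimately have "\<delta> = \<delta>\<^sub>1" using polar_unique r by blast
      then have "\<delta>\<^sub>1 = \<gamma>" using d d1 by linarith
      then show False using zr d1(3) by (auto simp: inside_def)
    qed
    have "p + of_real r * cis (\<beta> + \<eta> - 2 * pi) \<in> inside L"
    proof (rule circular_arc_inside[OF r(1) zr])
      show "\<gamma> \<in> {\<beta> + \<eta> - 2 * pi..\<gamma>}" "\<beta> + \<eta> - 2 * pi \<in> {\<beta> + \<eta> - 2 * pi..\<gamma>}"
        using \<gamma>(1) small by auto
    qed (use free in auto)
    then have "p + of_real r * cis (\<beta> + \<eta>) \<in> inside L"
      by (simp add: cis_add_2pi)
    moreover have "p + of_real r * cis (\<beta> + \<eta>) \<in> sector p \<rho> (\<beta> + \<eta>) (\<alpha> + 2 * pi - \<eta>)"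
      using r small by (force simp: sector_def)
    ultimately show ?thesis
      using connected_subset_inside[OF connected_sector free2] by blast
  qed
qed

section \<open>A smooth loop near its base point\<close>

lemma difference_quotient_right:
  fixes c :: "real \<Rightarrow> complex"
  assumes "(c has_vector_derivative v) (at a)"
  shows "((\<lambda>u. (c u - c a) /\<^sub>R (u - a)) \<longlongrightarrow> v) (at_right a)"
proof -
  have "(c has_vector_derivative v) (at_right a)"
    using assms has_vector_derivative_at_within by blast
  then have "((\<lambda>u. (c u - (c a + (u - a) *\<^sub>R v)) /\<^sub>R norm (u - a)) \<longlongrightarrow> 0) (at_right a)"
    by (simp add: has_vector_derivative_def has_derivative_within divide_inverse)
  then have "((\<lambda>u. (c u - (c a + (u - a) *\<^sub>R v)) /\<^sub>R norm (u - a) + v) \<longlongrightarrow> 0 + v) (at_right a)"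
    by (intro tendsto_add tendsto_const)
  moreover have "eventually (\<lambda>u. (c u - (c a + (u - a) *\<^sub>R v)) /\<^sub>R norm (u - a) + v 
     = (c u - c a) /\<^sub>R (u - a)) (at_right a)"
    using eventually_at_right_less[of a]
  proof eventually_elim
    case (elim u)
    have "(c u - (c a + (u - a) *\<^sub>R v)) /\<^sub>R norm (u - a)
        = (c u - c a) /\<^sub>R (u - a) - (inverse (u - a) * (u - a)) *\<^sub>R v"
      using elim by (simp only: scaleR_scaleR[symmetric]) (simp add: algebra_simps)
    then show ?case using elim by simp
  qed
  ultimately show ?thesis by (simp add: tendsto_cong)
qed

lemma eventually_in_tangent_cone:
  fixes c :: "real \<Rightarrow> complex"
  assumes "(c has_vector_derivative of_real l * cis \<alpha>) (at a)" "0 < l" "0 < \<eta>" "\<eta> < pi"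
  shows "eventually (\<lambda>u. c u \<in> angular_cone (c a) \<alpha> \<eta>) (at_right a)"
proof -
  let ?q = "\<lambda>u. (c u - c a) /\<^sub>R (u - a)"
  have q: "(?q \<longlongrightarrow> of_real l * cis \<alpha>) (at_right a)"
    by (rule difference_quotient_right) fact
  have "((\<lambda>u. Re (?q u * cis (- \<alpha>)) - cos \<eta> * cmod (?q u))
      \<longlongrightarrow> Re (of_real l * cis \<alpha> * cis (- \<alpha>)) - cos \<eta> * cmod (of_real l * cis \<alpha>)) (at_right a)"
    by (intro tendsto_intros q)
  moreover have "Re (of_real l * cis \<alpha> * cis (- \<alpha>)) - cos \<eta> * cmod (of_real l * cis \<alpha>) > 0"
  proof -
    have "cos \<eta> < 1" using cos_monotone_0_pi[of 0 \<eta>] assms by simp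
    then show ?thesis using assms by (simp add: mult.assoc cis_mult norm_mult)
  qed
  ultimately have "eventually (\<lambda>u. Re (?q u * cis (- \<alpha>)) - cos \<eta> * cmod (?q u) > 0) (at_right a)"
    by (rule order_tendstoD(1))
  then show ?thesis using eventually_at_right_less[of a]
  proof eventually_elim
    case (elim u)
    have "Re (?q u * cis (- \<alpha>)) = Re ((c u - c a) * cis (- \<alpha>)) / (u - a)"
      by (simp only: Re_divide_of_real[symmetric]) (simp add: scaleR_conv_of_real divide_inverse mult_ac)
    moreover have "cmod (?q u) = cmod (c u - c a) / (u - a)"
      using elim by (simp only: norm_scaleR) (simp add: divide_inverse mult.commute)
    ultimately have "(Re ((c u - c a) * cis (- \<alpha>)) - cos \<eta> * cmod (c u - c a)) / (u - a) > 0"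
      using elim by (simp add: diff_divide_distrib)
    then show ?case using elim by (simp add: angular_cone_def zero_less_divide_iff)
  qed
qed

text \<open>The derivative of the squared distance from \<open>c a\<close> is \<open>2 \<langle>c u - c a, c' u\<rangle>\<close>, which is close to
  \<open>2 (u - a) |c' a|\<^sup>2\<close>.\<close>

lemma radius_increasing:
  fixes c :: "real \<Rightarrow> complex"
  assumes c: "\<And>u. (c has_vector_derivative c' u) (at u)" and "isCont c' a" "c' a \<noteq> 0"
  obtains \<delta> where "\<delta> > 0" 
    "\<And>u v. a < u \<Longrightarrow> u < v \<Longrightarrow> v < a + \<delta> \<Longrightarrow> cmod (c u - c a) < cmod (c v - c a)"
proof -
  let ?f = "\<lambda>u. (c u - c a) \<bullet> (c u - c a)"
  have f: "(?f has_real_derivative 2 * ((c u - c a) \<bullet> c' u)) (at u)" for u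
  proof -
    have "((\<lambda>u. c u - c a) has_vector_derivative c' u) (at u)"
      by (simp add: has_vector_derivative_diff_const c)
    then have "((\<lambda>u. c u - c a) has_derivative (\<lambda>x. x *\<^sub>R c' u)) (at u)"
      by (simp add: has_vector_derivative_def)
    from has_derivative_inner[OF this this] show ?thesis
      unfolding has_field_derivative_def
      by (rule has_derivative_eq_rhs) (simp add: fun_eq_iff inner_commute algebra_simps)
  qed
  have "((\<lambda>u. ((c u - c a) /\<^sub>R (u - a)) \<bullet> c' u) \<longlongrightarrow> c' a \<bullet> c' a) (at_right a)"
    using assms by (intro tendsto_intros difference_quotient_right)
       (auto simp: isCont_def intro: tendsto_within_subset)
  moreover have "c' a \<bullet> c' a > 0" using assms by simp
  ultimately have "eventually (\<lambda>u. ((c u - c a) /\<^sub>R (u - a)) \<bullet> c' u > 0) (at_right a)"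
    by (rule order_tendstoD(1))
  then obtain b where b: "a < b" "\<And>u. a < u \<Longrightarrow> u < b \<Longrightarrow> ((c u - c a) /\<^sub>R (u - a)) \<bullet> c' u > 0"
    unfolding eventually_at_right_field by blast
  have pos: "2 * ((c u - c a) \<bullet> c' u) > 0" if "a < u" "u < b" for u
    using b(2)[OF that] that by (simp add: zero_less_mult_iff)
  show thesis
  proof (rule that[of "b - a"])
    show "b - a > 0" using b by simp
    fix u v assume uv: "a < u" "u < v" "v < a + (b - a)"
    have "?f u < ?f v"
    proof (rule DERIV_pos_imp_increasing[OF uv(2)])
      fix x assume "u \<le> x" "x \<le> v"
      then show "\<exists>y. (?f has_real_derivative y) (at x) \<and> 0 < y"
        using uv f[of x] pos[of x] by (intro exI[of _ "2 * ((c x - c a) \<bullet> c' x)"]) auto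
    qed
    then show "cmod (c u - c a) < cmod (c v - c a)" by (simp add: norm_eq_sqrt_inner)
  qed
qed

lemma angular_cones_disjoint:
  assumes "0 < \<eta>" "\<alpha> + 2 * \<eta> < \<beta>" "\<beta> + 2 * \<eta> < \<alpha> + 2 * pi"
  shows "angular_cone p \<alpha> \<eta> \<inter> angular_cone p \<beta> \<eta> = {}"
proof (rule equals0I)
  fix z assume z: "z \<in> angular_cone p \<alpha> \<eta> \<inter> angular_cone p \<beta> \<eta>"
  have eta: "\<eta> < pi" using assms by simp
  obtain \<gamma> where g: "\<bar>\<gamma> - \<alpha>\<bar> < \<eta>" "z = p + of_real (cmod (z - p)) * cis \<gamma>" "z \<noteq> p"
    using z angular_cone_polar[OF _ assms(1) eta] by blast
  obtain \<gamma>' where g': "\<bar>\<gamma>' - \<beta>\<bar> < \<eta>" "z = p + of_real (cmod (z - p)) * cis \<gamma>'"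
    using z angular_cone_polar[OF _ assms(1) eta] by blast
  have "\<gamma> = \<gamma>'"
  proof (rule polar_unique)
    show "p + of_real (cmod (z - p)) * cis \<gamma> = p + of_real (cmod (z - p)) * cis \<gamma>'"
      using g(2) g'(2) by simp
    show "\<bar>\<gamma> - \<gamma>'\<bar> < 2 * pi" using g(1) g'(1) assms by linarith
  qed (use g in auto)
  then show False using g(1) g'(1) assms by linarith
qed

text \<open>The hypotheses of \<open>jordan_curve_fills_a_sector\<close> hold for a loop of a smooth curve whose two
  branches at \<open>p\<close> leave in different directions: compactness keeps the middle part of the loop away
  from \<open>p\<close>, the tangents confine the two end parts to cones, and regularity makes the radius
  injective on the first of them. The set \<open>L\<close> may omit parts of the loop away from \<open>p\<close>, as it does
  when half-twists have been removed.\<close>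

lemma petal_fills_a_sector:
  fixes c :: "real \<Rightarrow> complex"
  assumes c: "\<And>u. (c has_vector_derivative c' u) (at u)" and c': "isCont c' a"
    and ends: "a < e" "c a = p" "c e = p" "\<And>u. a < u \<Longrightarrow> u < e \<Longrightarrow> c u \<noteq> p"
    and out: "c' a = of_real l * cis \<alpha>" "0 < l" and inn: "- c' e = of_real m * cis \<beta>" "0 < m"
    and L: "L \<subseteq> c ` {a..e}" "L \<subseteq> closure (inside L)"
    and near: "0 < \<epsilon>" "\<And>u. a \<le> u \<Longrightarrow> u < e \<Longrightarrow> cmod (c u - p) < \<epsilon> \<Longrightarrow> c u \<in> L"
    and small: "0 < \<eta>" "\<alpha> + 2 * \<eta> < \<beta>" "\<beta> + 2 * \<eta> < \<alpha> + 2 * pi"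
  obtains \<rho> where "0 < \<rho>" "sector p \<rho> (\<alpha> + \<eta>) (\<beta> - \<eta>) \<subseteq> inside L
       \<or> sector p \<rho> (\<beta> + \<eta>) (\<alpha> + 2 * pi - \<eta>) \<subseteq> inside L"
proof -
  have eta: "\<eta> < pi" using small by simp
  have cont: "continuous_on S c" for S
    using c by (meson continuous_at_imp_continuous_on has_vector_derivative_continuous)
  obtain \<delta>\<^sub>1 where d1: "\<delta>\<^sub>1 > 0"
    "\<And>u v. a < u \<Longrightarrow> u < v \<Longrightarrow> v < a + \<delta>\<^sub>1 \<Longrightarrow> cmod (c u - p) < cmod (c v - p)"
    using radius_increasing[OF c c'] out ends(2) by auto
  have "eventually (\<lambda>u. c u \<in> angular_cone p \<alpha> \<eta>) (at_right a)"
    using eventually_in_tangent_cone[of c l \<alpha> a \<eta>] c[of a] out ends small eta by simp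
  then obtain b where b: "a < b" "\<And>u. a < u \<Longrightarrow> u < b \<Longrightarrow> c u \<in> angular_cone p \<alpha> \<eta>"
    unfolding eventually_at_right_field by blast
  \<comment> \<open>The incoming end is an outgoing end of the reversed curve.\<close>
  have "((\<lambda>u. c (- u)) has_vector_derivative of_real m * cis \<beta>) (at (- e))"
  proof -
    have "(uminus has_vector_derivative - 1) (at (- e))"
      by (auto intro!: derivative_eq_intros)
    from vector_diff_chain_at[OF this, of c "c' e"] c[of e] show ?thesis
      by (simp add: o_def inn)
  qed
  then have "eventually (\<lambda>u. c (- u) \<in> angular_cone p \<beta> \<eta>) (at_right (- e))"
    using eventually_in_tangent_cone[of "\<lambda>u. c (- u)" m \<beta> "- e" \<eta>] inn ends small eta by simp
  then obtain b' where b': "- e < b'" "\<And>u. - e < u \<Longrightarrow> u < b' \<Longrightarrow> c (- u) \<in> angular_cone p \<beta> \<eta>"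
    unfolding eventually_at_right_field by blast
  define \<delta> where "\<delta> = Min {\<delta>\<^sub>1, b - a, b' + e, (e - a) / 3}"
  have "\<delta> > 0" "\<delta> \<le> \<delta>\<^sub>1" "\<delta> \<le> b - a" "\<delta> \<le> b' + e" "\<delta> \<le> (e - a) / 3"
    using d1(1) b(1) b'(1) ends(1) unfolding \<delta>_def by (auto simp: min_def)
  note d = this
  have outarc: "c u \<in> angular_cone p \<alpha> \<eta>" if "a < u" "u < a + \<delta>" for u
    using b(2)[of u] that d by simp
  have inarc: "c u \<in> angular_cone p \<beta> \<eta>" if "e - \<delta> < u" "u < e" for u
    using b'(2)[of "- u"] that d by simp
  have "closed (c ` {a + \<delta>..e - \<delta>})"
    by (intro compact_imp_closed compact_continuous_image cont) auto
  moreover have "p \<notin> c ` {a + \<delta>..e - \<delta>}" 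
  proof
    assume "p \<in> c ` {a + \<delta>..e - \<delta>}"
    then obtain u where "a + \<delta> \<le> u" "u \<le> e - \<delta>" "c u = p" by auto
    then show False using ends(4)[of u] d(1) by linarith
  qed
  ultimately obtain \<rho> where rho: "\<rho> > 0" "\<And>z. z \<in> c ` {a + \<delta>..e - \<delta>} \<Longrightarrow> \<rho> \<le> dist p z"
    using separate_point_closed by metis
  have arcs: "\<exists>u. z = c u \<and> (a < u \<and> u < a + \<delta> \<or> e - \<delta> < u \<and> u < e)"
    if z: "z \<in> L" "z \<noteq> p" "cmod (z - p) < \<rho>" for z
  proof -
    obtain u where u: "a \<le> u" "u \<le> e" "z = c u" using subsetD[OF L(1) z(1)] by auto
    have "u \<noteq> a" "u \<noteq> e" using u z ends by auto
    moreover have "u \<notin> {a + \<delta>..e - \<delta>}"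
      using rho(2)[of z] u(3) z(3) by (auto simp: dist_norm norm_minus_commute)
    ultimately show ?thesis using u by (intro exI[of _ u]) auto
  qed
  \<comment> \<open>A point of the outgoing branch that belongs to \<open>L\<close> and so is a limit of points of the inside.\<close>
  have "\<exists>u. a < u \<and> u < a + \<delta> \<and> cmod (c u - p) < min \<rho> \<epsilon>"
  proof -
    have "((\<lambda>u. cmod (c u - p)) \<longlongrightarrow> cmod (c a - p)) (at_right a)"
      using has_vector_derivative_continuous[OF c[of a]]
      by (intro tendsto_intros) (auto simp: isCont_def continuous_within intro: tendsto_within_subset)
    then have "eventually (\<lambda>u. cmod (c u - p) < min \<rho> \<epsilon>) (at_right a)"
      using rho near(1) ends by (intro order_tendstoD(2)) auto
    moreover have "eventually (\<lambda>u. a < u \<and> u < a + \<delta>) (at_right a)"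
      using d unfolding eventually_at_right_field by (intro exI[of _ "a + \<delta>"]) auto
    ultimately have "eventually (\<lambda>u. a < u \<and> u < a + \<delta> \<and> cmod (c u - p) < min \<rho> \<epsilon>) (at_right a)"
      by (rule eventually_elim2) auto
    then show ?thesis by (rule eventually_happens'[OF trivial_limit_at_right_real])
  qed
  then obtain u\<^sub>0 where u0: "a < u\<^sub>0" "u\<^sub>0 < a + \<delta>" "cmod (c u\<^sub>0 - p) < \<rho>" "cmod (c u\<^sub>0 - p) < \<epsilon>"
    by auto
  show thesis
  proof (rule that[OF rho(1)], rule jordan_curve_fills_a_sector[OF rho(1) small])
    show "c u\<^sub>0 \<in> angular_cone p \<alpha> \<eta>" by (rule outarc[OF u0(1,2)])
    show "cmod (c u\<^sub>0 - p) < \<rho>" by fact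
    have "c u\<^sub>0 \<in> L" using u0 d(1,5) ends(1) by (intro near(2)) (auto simp: field_simps)
    then show "c u\<^sub>0 \<in> closure (inside L)" using L(2) by blast
    show "z \<in> angular_cone p \<alpha> \<eta> \<or> z \<in> angular_cone p \<beta> \<eta>"
      if "z \<in> L" "z \<noteq> p" "cmod (z - p) < \<rho>" for z
      using arcs[OF that] outarc inarc by blast
    fix z z' assume z: "z \<in> L" "z' \<in> L" "z \<in> angular_cone p \<alpha> \<eta>" "z' \<in> angular_cone p \<alpha> \<eta>"
      "cmod (z - p) < \<rho>" "cmod (z' - p) = cmod (z - p)"
    have "\<exists>u. x = c u \<and> a < u \<and> u < a + \<delta>"
      if "x \<in> L" "x \<in> angular_cone p \<alpha> \<eta>" "cmod (x - p) < \<rho>" for x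
    proof -
      have "x \<noteq> p" using that by (auto simp: angular_cone_def)
      then show ?thesis
        using arcs[of x] that inarc angular_cones_disjoint[OF small, of p] by blast
    qed
    then obtain u v where "z = c u" "a < u" "u < a + \<delta>" "z' = c v" "a < v" "v < a + \<delta>"
      using z by metis
    moreover from this have "u = v"
      using d1(2)[of u v] d1(2)[of v u] z(6) d(2) by (cases u v rule: linorder_cases) auto
    ultimately show "z = z'" by simp
  qed
qed

section \<open>Petals as Jordan curves\<close>

text \<open>After arcs have been removed, the remaining parameters \<open>R\<close> form a union of intervals.
  Their increasing enumeration \<open>\<theta>\<close> by the whole interval jumps, but its composition with the curve is
  required to be continuous. So \<open>c \<circ> \<theta>\<close> is a path that runs through the remaining diagram.\<close>

definition traversal :: "(real \<Rightarrow> complex) \<Rightarrow> real \<Rightarrow> real \<Rightarrow> real set \<Rightarrow> (real \<Rightarrow> real) \<Rightarrow> bool" where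
  "traversal c t\<^sub>0 t\<^sub>1 R \<theta> \<longleftrightarrow> strict_mono_on {t\<^sub>0..t\<^sub>1} \<theta> \<and> \<theta> ` {t\<^sub>0..t\<^sub>1} = insert t\<^sub>1 R
     \<and> continuous_on {t\<^sub>0..t\<^sub>1} (c \<circ> \<theta>)"

lemma traversal_id:
  assumes "continuous_on UNIV c" "t\<^sub>0 < t\<^sub>1"
  shows "traversal c t\<^sub>0 t\<^sub>1 {t\<^sub>0..<t\<^sub>1} id"
  using assms by (auto simp: traversal_def strict_mono_on_def intro: continuous_on_subset)

text \<open>The new enumeration is the old one after a change of parameter that is the identity up to the
  place of \<open>s\<close> and then stretches the rest of the interval affinely over the part after the place of
  \<open>t\<close>. The curve takes the same value at both places, so the composition stays continuous.\<close>

lemma traversal_cut: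
  assumes \<theta>: "traversal c t\<^sub>0 t\<^sub>1 R \<theta>" and R: "R \<subseteq> {t\<^sub>0..<t\<^sub>1}"
    and st: "s \<in> R" "t \<in> R" "s < t" "c s = c t"
  shows "\<exists>\<theta>'. traversal c t\<^sub>0 t\<^sub>1 (R - {s<..t}) \<theta>'"
proof -
  have mono: "\<And>u v. u \<in> {t\<^sub>0..t\<^sub>1} \<Longrightarrow> v \<in> {t\<^sub>0..t\<^sub>1} \<Longrightarrow> \<theta> u < \<theta> v \<longleftrightarrow> u < v"
    using \<theta> strict_mono_on_less unfolding traversal_def by blast
  have im: "\<theta> ` {t\<^sub>0..t\<^sub>1} = insert t\<^sub>1 R" and cont: "continuous_on {t\<^sub>0..t\<^sub>1} (c \<circ> \<theta>)"
    using \<theta> by (auto simp: traversal_def)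
  have "s \<in> \<theta> ` {t\<^sub>0..t\<^sub>1}" "t \<in> \<theta> ` {t\<^sub>0..t\<^sub>1}" using im st by auto
  then obtain x y where x: "x \<in> {t\<^sub>0..t\<^sub>1}" "\<theta> x = s" and y: "y \<in> {t\<^sub>0..t\<^sub>1}" "\<theta> y = t" by auto
  have xy: "x < y" using mono[OF x(1) y(1)] x y st by simp
  have "t\<^sub>1 \<in> \<theta> ` {t\<^sub>0..t\<^sub>1}" using im by simp
  then obtain w where w: "w \<in> {t\<^sub>0..t\<^sub>1}" "\<theta> w = t\<^sub>1" by auto
  have "y < w" using mono[OF y(1) w(1)] y w st R by auto
  then have yT: "y < t\<^sub>1" using w by auto
  then have xT: "x < t\<^sub>1" using xy by simp
  \<comment> \<open>\<open>\<sigma>\<close> is discontinuous at \<open>x\<close>, where it jumps from \<open>x\<close> to \<open>y\<close>.\<close>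
  define k where "k = (t\<^sub>1 - y) / (t\<^sub>1 - x)"
  define \<sigma> where "\<sigma> u = (if u \<le> x then u else y + (u - x) * k)" for u
  have k: "k > 0" "y + (t\<^sub>1 - x) * k = t\<^sub>1" using yT xT by (auto simp: k_def)
  have s1: "\<sigma> ` {t\<^sub>0..t\<^sub>1} = {t\<^sub>0..x} \<union> {y<..t\<^sub>1}"
  proof (intro equalityI subsetI)
    fix v assume "v \<in> \<sigma> ` {t\<^sub>0..t\<^sub>1}"
    then obtain u where u: "u \<in> {t\<^sub>0..t\<^sub>1}" "v = \<sigma> u" by auto
    show "v \<in> {t\<^sub>0..x} \<union> {y<..t\<^sub>1}"
    proof (cases "u \<le> x")
      case False
      then have "(u - x) * k \<le> (t\<^sub>1 - x) * k" using u k by (intro mult_right_mono) auto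
      moreover have "(u - x) * k > 0" using False k by simp
      ultimately show ?thesis using u False k(2) by (auto simp: \<sigma>_def)
    qed (use u in \<open>auto simp: \<sigma>_def\<close>)
  next
    fix v assume v: "v \<in> {t\<^sub>0..x} \<union> {y<..t\<^sub>1}"
    show "v \<in> \<sigma> ` {t\<^sub>0..t\<^sub>1}"
    proof (cases "v \<in> {t\<^sub>0..x}")
      case True
      then show ?thesis using x by (auto simp: \<sigma>_def intro!: image_eqI[of _ _ v])
    next
      case False
      then have v': "y < v" "v \<le> t\<^sub>1" using v by auto
      define u where "u = x + (v - y) / k"
      have "(v - y) / k \<le> (t\<^sub>1 - y) / k" using v' k by (intro divide_right_mono) auto
      also have "(t\<^sub>1 - y) / k = t\<^sub>1 - x" using k(1,2) by (simp add: field_simps)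
      finally have "u \<le> t\<^sub>1" by (simp add: u_def)
      moreover have "u > x" using v' k by (simp add: u_def)
      moreover have "(u - x) * k = v - y" using k by (simp add: u_def)
      ultimately show ?thesis using x by (intro image_eqI[of _ _ u]) (auto simp: \<sigma>_def)
    qed
  qed
  have s2: "strict_mono_on {t\<^sub>0..t\<^sub>1} \<sigma>"
  proof (rule strict_mono_onI)
    fix u v assume uv: "u \<in> {t\<^sub>0..t\<^sub>1}" "v \<in> {t\<^sub>0..t\<^sub>1}" "u < v"
    have "(u - x) * k < (v - x) * k" using uv k by simp
    moreover have "(v - x) * k > 0" if "v > x" using that k by simp
    ultimately show "\<sigma> u < \<sigma> v" using uv xy by (auto simp: \<sigma>_def)
  qed
  have sub: "{t\<^sub>0..x} \<union> {y<..t\<^sub>1} \<subseteq> {t\<^sub>0..t\<^sub>1}" using x y by auto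
  have "strict_mono_on {t\<^sub>0..t\<^sub>1} (\<theta> \<circ> \<sigma>)"
  proof (rule strict_mono_onI)
    fix u v assume uv: "u \<in> {t\<^sub>0..t\<^sub>1}" "v \<in> {t\<^sub>0..t\<^sub>1}" "u < v"
    then have "\<sigma> u < \<sigma> v" using s2 by (auto simp: strict_mono_on_def)
    moreover have "\<sigma> u \<in> {t\<^sub>0..t\<^sub>1}" "\<sigma> v \<in> {t\<^sub>0..t\<^sub>1}" using uv s1 sub by blast+
    ultimately show "(\<theta> \<circ> \<sigma>) u < (\<theta> \<circ> \<sigma>) v" using mono by simp
  qed
  moreover have "(\<theta> \<circ> \<sigma>) ` {t\<^sub>0..t\<^sub>1} = insert t\<^sub>1 (R - {s<..t})"
  proof -
    have "(\<theta> \<circ> \<sigma>) ` {t\<^sub>0..t\<^sub>1} = \<theta> ` {u \<in> {t\<^sub>0..t\<^sub>1}. \<not> (x < u \<and> u \<le> y)}"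
      unfolding image_comp[symmetric] s1 using x y by (intro arg_cong[where f = "(`) \<theta>"]) auto
    also have "\<dots> = \<theta> ` {t\<^sub>0..t\<^sub>1} - {s<..t}"
    proof -
      have "\<theta> u \<in> {s<..t} \<longleftrightarrow> x < u \<and> u \<le> y" if "u \<in> {t\<^sub>0..t\<^sub>1}" for u
        using mono[OF x(1) that] mono[OF y(1) that] x(2) y(2) by (auto simp: not_less[symmetric])
      then show ?thesis by blast
    qed
    also have "\<dots> = insert t\<^sub>1 (R - {s<..t})" unfolding im using st R by auto
    finally show ?thesis .
  qed
  moreover have "continuous_on {t\<^sub>0..t\<^sub>1} (c \<circ> (\<theta> \<circ> \<sigma>))"
  proof -
    have "continuous_on ({t\<^sub>0..x} \<union> {x..t\<^sub>1})
       (\<lambda>u. if u \<le> x then (c \<circ> \<theta>) u else (c \<circ> \<theta>) (y + (u - x) * k))"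
    proof (rule continuous_on_cases)
      show "continuous_on {t\<^sub>0..x} (c \<circ> \<theta>)" using cont x by (rule_tac continuous_on_subset) auto
      have "(\<lambda>u. y + (u - x) * k) ` {x..t\<^sub>1} \<subseteq> {t\<^sub>0..t\<^sub>1}"
      proof clarify
        fix u assume "u \<in> {x..t\<^sub>1}"
        then have "0 \<le> (u - x) * k" "(u - x) * k \<le> (t\<^sub>1 - x) * k" using k by (auto intro: mult_right_mono)
        then show "y + (u - x) * k \<in> {t\<^sub>0..t\<^sub>1}" using k(2) y by auto
      qed
      then show "continuous_on {x..t\<^sub>1} (\<lambda>u. (c \<circ> \<theta>) (y + (u - x) * k))"
        by (intro continuous_on_compose2[OF cont] continuous_intros)
      show "\<forall>u. u \<in> {t\<^sub>0..x} \<and> \<not> u \<le> x \<or> u \<in> {x..t\<^sub>1} \<and> u \<le> x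
          \<longrightarrow> (c \<circ> \<theta>) u = (c \<circ> \<theta>) (y + (u - x) * k)"
        using x y st by auto
    qed auto
    moreover have "{t\<^sub>0..x} \<union> {x..t\<^sub>1} = {t\<^sub>0..t\<^sub>1}" using x by auto
    moreover have "c \<circ> (\<theta> \<circ> \<sigma>) = (\<lambda>u. if u \<le> x then (c \<circ> \<theta>) u else (c \<circ> \<theta>) (y + (u - x) * k))"
      by (auto simp: \<sigma>_def fun_eq_iff)
    ultimately show ?thesis by simp
  qed
  ultimately show ?thesis unfolding traversal_def by blast
qed

text \<open>The properties of a period that survive the removal of half-twists. The second clause says that
  nothing close to \<open>p\<close> has been removed, so the rays at \<open>p\<close> are still those of the smooth knot.\<close>

definition reduced_period :: "(real \<Rightarrow> real ^ 3) \<Rightarrow> complex \<Rightarrow> real \<Rightarrow> real set \<Rightarrow> bool" where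
  "reduced_period g p t\<^sub>0 R \<longleftrightarrow> R \<subseteq> {t\<^sub>0..<t\<^sub>0 + 1}
     \<and> (\<exists>\<epsilon>>0. \<forall>u\<in>{t\<^sub>0..<t\<^sub>0 + 1}. cmod (lagr g u - p) < \<epsilon> \<longrightarrow> u \<in> R)
     \<and> (\<exists>\<theta>. traversal (lagr g) t\<^sub>0 (t\<^sub>0 + 1) R \<theta>)"

lemma untwisting:
  assumes "twisted_petals g p R k" "reduced_period g p t\<^sub>0 R" and cont: "continuous_on UNIV (lagr g)"
  obtains R' where "reduced_period g p t\<^sub>0 R'" "no_other_crossing g p R'" "no_nested_loops g p R'"
proof -
  have "\<exists>R'. reduced_period g p t\<^sub>0 R' \<and> no_other_crossing g p R' \<and> no_nested_loops g p R'"
    using assms(1,2)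
  proof (induction)
    case (twist R s t k)
    have st: "s \<in> R" "t \<in> R" "s < t" "lagr g s = lagr g t" "p \<notin> lagr g ` {s..t}"
      using twist.hyps(1) by (auto simp: half_twist_def)
    obtain \<epsilon> where e: "\<epsilon> > 0" "\<And>u. u \<in> {t\<^sub>0..<t\<^sub>0 + 1} \<Longrightarrow> cmod (lagr g u - p) < \<epsilon> \<Longrightarrow> u \<in> R"
      using twist.prems by (auto simp: reduced_period_def)
    have "closed (lagr g ` {s..t})"
      by (intro compact_imp_closed compact_continuous_image continuous_on_subset[OF cont]) auto
    then obtain \<epsilon>' where e': "\<epsilon>' > 0" "\<And>z. z \<in> lagr g ` {s..t} \<Longrightarrow> \<epsilon>' \<le> dist p z"
      using separate_point_closed st(5) by metis
    have "u \<in> R - {s<..t}" if "u \<in> {t\<^sub>0..<t\<^sub>0 + 1}" "cmod (lagr g u - p) < min \<epsilon> \<epsilon>'" for u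
    proof -
      have "u \<notin> {s..t}" using e'(2)[of "lagr g u"] that by (auto simp: dist_norm norm_minus_commute)
      then show ?thesis using e(2)[of u] that by auto
    qed
    then have "\<exists>\<epsilon>>0. \<forall>u\<in>{t\<^sub>0..<t\<^sub>0 + 1}. cmod (lagr g u - p) < \<epsilon> \<longrightarrow> u \<in> R - {s<..t}"
      using e(1) e'(1) by (intro exI[of _ "min \<epsilon> \<epsilon>'"]) auto
    moreover have "\<exists>\<theta>. traversal (lagr g) t\<^sub>0 (t\<^sub>0 + 1) (R - {s<..t}) \<theta>"
      using twist.prems traversal_cut st by (auto simp: reduced_period_def)
    ultimately have "reduced_period g p t\<^sub>0 (R - {s<..t})"
      using twist.prems by (auto simp: reduced_period_def)
    then show ?case by (rule twist.IH)
  qed blast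
  then show thesis using that by blast
qed

lemma loop_at_eq:
  assumes "e \<in> insert t\<^sub>1 R" "R \<subseteq> {t\<^sub>0..<t\<^sub>1}" "a < e" "lagr g e = p"
    "\<And>u. a < u \<Longrightarrow> u < e \<Longrightarrow> lagr g u \<noteq> p"
  shows "loop_at g p R a = lagr g ` (R \<inter> {a..<e})"
proof -
  have "{u \<in> R. a \<le> u \<and> (\<forall>w\<in>{a<..u}. lagr g w \<noteq> p)} = R \<inter> {a..<e}"
    using assms by (force simp: not_le)
  then show ?thesis by (simp add: loop_at_def)
qed

text \<open>A petal is a simple closed path, being the restriction of a traversal to the parameters between
  two consecutive visits of \<open>p\<close>; by the Jordan curve theorem it is the frontier of its inside.\<close>

lemma petal_in_closure_inside:
  assumes R: "reduced_period g p t\<^sub>0 R" "no_other_crossing g p R"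
    and ae: "a \<in> R" "e \<in> insert (t\<^sub>0 + 1) R" "a < e" "lagr g a = p" "lagr g e = p"
      "\<And>u. a < u \<Longrightarrow> u < e \<Longrightarrow> lagr g u \<noteq> p"
  shows "loop_at g p R a \<subseteq> closure (inside (loop_at g p R a))"
proof -
  obtain \<theta> where \<theta>: "strict_mono_on {t\<^sub>0..t\<^sub>0+1} \<theta>" and im: "\<theta> ` {t\<^sub>0..t\<^sub>0+1} = insert (t\<^sub>0+1) R"
    and cont: "continuous_on {t\<^sub>0..t\<^sub>0+1} (lagr g \<circ> \<theta>)" and RT: "R \<subseteq> {t\<^sub>0..<t\<^sub>0 + 1}"
    using R by (auto simp: reduced_period_def traversal_def)
  have mono: "\<And>u v. u \<in> {t\<^sub>0..t\<^sub>0+1} \<Longrightarrow> v \<in> {t\<^sub>0..t\<^sub>0+1} \<Longrightarrow> \<theta> u < \<theta> v \<longleftrightarrow> u < v"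
    using \<theta> strict_mono_on_less by blast
  have "a \<in> \<theta> ` {t\<^sub>0..t\<^sub>0+1}" "e \<in> \<theta> ` {t\<^sub>0..t\<^sub>0+1}" using im ae by auto
  then obtain x y where x: "x \<in> {t\<^sub>0..t\<^sub>0+1}" "\<theta> x = a" and y: "y \<in> {t\<^sub>0..t\<^sub>0+1}" "\<theta> y = e" by auto
  have xy: "x < y" using mono[OF x(1) y(1)] x y ae by simp
  define \<gamma> where "\<gamma> = lagr g \<circ> \<theta> \<circ> linepath x y"
  have lp: "linepath x y ` {0..1} = {x..y}"
    using xy path_image_linepath[of x y] by (simp add: path_image_def closed_segment_eq_real_ivl)
  have "path \<gamma>"
    unfolding path_def \<gamma>_def using x y lp
    by (intro continuous_on_compose continuous_on_subset[OF cont]) (auto)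
  have ends: "pathstart \<gamma> = p" "pathfinish \<gamma> = p"
    using x y ae by (auto simp: \<gamma>_def pathstart_def pathfinish_def linepath_def)
  have image: "path_image \<gamma> = loop_at g p R a"
  proof -
    have 1: "\<theta> ` {x..y} = insert (t\<^sub>0+1) R \<inter> {a..e}"
    proof -
      have "\<theta> u \<in> {a..e} \<longleftrightarrow> u \<in> {x..y}" if "u \<in> {t\<^sub>0..t\<^sub>0+1}" for u
        using mono[OF that x(1)] mono[OF y(1) that] x y by (auto simp: not_less[symmetric])
      then show ?thesis unfolding im[symmetric] using x y by force
    qed
    have "path_image \<gamma> = lagr g ` (insert (t\<^sub>0+1) R \<inter> {a..e})"
      unfolding \<gamma>_def path_image_def image_comp[symmetric] lp 1 ..
    also have "insert (t\<^sub>0+1) R \<inter> {a..e} = insert e (R \<inter> {a..<e})" using ae RT by force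
    also have "lagr g ` \<dots> = lagr g ` (R \<inter> {a..<e})" using ae by force
    also have "\<dots> = loop_at g p R a" using loop_at_eq[OF ae(2) RT ae(3,5)] ae(6) by blast
    finally show ?thesis .
  qed
  have inj: "u = x \<and> v = y" if uv: "u \<in> {x..y}" "v \<in> {x..y}" "u < v" "lagr g (\<theta> u) = lagr g (\<theta> v)" for u v
  proof -
    have uvT: "u \<in> {t\<^sub>0..t\<^sub>0+1}" "v \<in> {t\<^sub>0..t\<^sub>0+1}" using uv x y by auto
    then have lt: "\<theta> u < \<theta> v" and "\<theta> u \<in> insert (t\<^sub>0+1) R" "\<theta> v \<in> insert (t\<^sub>0+1) R"
      using mono uv im by auto
    moreover have "\<theta> v \<le> t\<^sub>0 + 1" using calculation RT by auto
    ultimately have uR: "\<theta> u \<in> R" by auto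
    have le: "a \<le> \<theta> u" "\<theta> v \<le> e" using mono[OF uvT(1) x(1)] mono[OF y(1) uvT(2)] uv x y by auto
    have "lagr g (\<theta> v) = p"
    proof (cases "\<theta> v \<in> R")
      case True
      then show ?thesis using R(2) uR uv(4) lt unfolding no_other_crossing_def by force
    next
      case False
      then have "\<theta> v = t\<^sub>0 + 1" using \<open>\<theta> v \<in> insert (t\<^sub>0+1) R\<close> by auto
      then have "e = t\<^sub>0 + 1" using le ae RT by auto
      then show ?thesis using ae \<open>\<theta> v = t\<^sub>0 + 1\<close> by simp
    qed
    then have "\<theta> u = a" "\<theta> v = e" using ae(6)[of "\<theta> u"] ae(6)[of "\<theta> v"] uv(4) le lt by force+
    then show ?thesis using mono[OF uvT(1) x(1)] mono[OF x(1) uvT(1)] mono[OF uvT(2) y(1)] mono[OF y(1) uvT(2)]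
      x(2) y(2) by auto
  qed
  have "loop_free \<gamma>"
    unfolding loop_free_def
  proof (intro ballI impI)
    fix u v :: real assume uv: "u \<in> {0..1}" "v \<in> {0..1}" "\<gamma> u = \<gamma> v"
    have l: "linepath x y u \<in> {x..y}" "linepath x y v \<in> {x..y}" using lp uv by auto
    have lin: "linepath x y w = x + w * (y - x)" for w by (simp add: linepath_def algebra_simps)
    have less: "linepath x y w < linepath x y w' \<longleftrightarrow> w < w'" for w w' using xy by (simp add: lin)
    have "linepath x y w = y \<longleftrightarrow> (w - 1) * (y - x) = 0" for w by (auto simp: lin algebra_simps)
    then have end0: "linepath x y w = x \<longleftrightarrow> w = 0" "linepath x y w = y \<longleftrightarrow> w = 1" for w
      using xy by (auto simp: lin)
    show "u = v \<or> u = 0 \<and> v = 1 \<or> u = 1 \<and> v = 0"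
      using inj[OF l] inj[OF l(2) l(1)] uv(3)
      unfolding less end0 \<gamma>_def o_def by (metis linorder_cases)
  qed
  then have "simple_path \<gamma>" using \<open>path \<gamma>\<close> by (simp add: simple_path_def)
  then have "frontier (inside (path_image \<gamma>)) = path_image \<gamma>"
    using Jordan_inside_outside[of \<gamma>] ends by auto
  then show ?thesis unfolding image frontier_def by blast
qed

section \<open>Rays of petals\<close>

text \<open>Two consecutive visits of \<open>p\<close> within a period. The end of the last arc is \<open>t\<^sub>0 + 1\<close>, which is
  not a member of the period.\<close>

definition petal_arc :: "(real \<Rightarrow> real ^ 3) \<Rightarrow> complex \<Rightarrow> real \<Rightarrow> real \<Rightarrow> real \<Rightarrow> bool" where
  "petal_arc g p t\<^sub>0 a e \<longleftrightarrow> t\<^sub>0 \<le> a \<and> a < e \<and> e \<le> t\<^sub>0 + 1 \<and> lagr g a = p \<and> lagr g e = p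
     \<and> (\<forall>u. a < u \<and> u < e \<longrightarrow> lagr g u \<noteq> p)"

text \<open>Every cone around the direction \<open>\<gamma>\<close>, however narrow, contains points of \<open>L\<close> arbitrarily close to
  \<open>p\<close>. So \<open>L\<close> enters every sector at \<open>p\<close> that has the direction \<open>\<gamma>\<close> in its interior.\<close>

definition has_ray :: "complex set \<Rightarrow> complex \<Rightarrow> real \<Rightarrow> bool" where
  "has_ray L p \<gamma> \<longleftrightarrow> (\<forall>\<eta> \<rho>. 0 < \<eta> \<and> \<eta> < pi \<and> 0 < \<rho> \<longrightarrow> (\<exists>z\<in>L. z \<in> angular_cone p \<gamma> \<eta> \<and> cmod (z - p) < \<rho>))"

lemma petal_arc_in_period:
  assumes "reduced_period g p t\<^sub>0 R" "petal_arc g p t\<^sub>0 a e"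
  shows "a \<in> R" "e \<in> insert (t\<^sub>0 + 1) R" "R \<subseteq> {t\<^sub>0..<t\<^sub>0 + 1}"
  using assms by (force simp: reduced_period_def petal_arc_def)+

lemma petal_arc_loop:
  assumes "reduced_period g p t\<^sub>0 R" "petal_arc g p t\<^sub>0 a e"
  shows "loop_at g p R a = lagr g ` (R \<inter> {a..<e})"
  using assms loop_at_eq[OF petal_arc_in_period(2,3)[OF assms]] by (auto simp: petal_arc_def)

lemma near_multi_crossing_in_loop:
  assumes "reduced_period g p t\<^sub>0 R" "petal_arc g p t\<^sub>0 a e"
  obtains \<epsilon> where "0 < \<epsilon>"
    "\<And>u. a \<le> u \<Longrightarrow> u < e \<Longrightarrow> cmod (lagr g u - p) < \<epsilon> \<Longrightarrow> lagr g u \<in> loop_at g p R a"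
proof -
  obtain \<epsilon> where e: "\<epsilon> > 0" "\<And>u. u \<in> {t\<^sub>0..<t\<^sub>0 + 1} \<Longrightarrow> cmod (lagr g u - p) < \<epsilon> \<Longrightarrow> u \<in> R"
    using assms by (auto simp: reduced_period_def)
  show thesis
    using e assms(2) by (intro that[of \<epsilon>]) (auto simp: petal_arc_loop[OF assms] petal_arc_def)
qed

lemma has_ray_eventually:
  assumes "(f \<longlongrightarrow> p) (at_right a)" "eventually (\<lambda>u. f u \<in> L) (at_right a)"
    and "\<And>\<eta>. 0 < \<eta> \<Longrightarrow> \<eta> < pi \<Longrightarrow> eventually (\<lambda>u. f u \<in> angular_cone p \<gamma> \<eta>) (at_right (a::real))"
  shows "has_ray L p \<gamma>"
  unfolding has_ray_def
proof clarify
  fix \<eta> \<rho> :: real assume *: "0 < \<eta>" "\<eta> < pi" "0 < \<rho>"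
  have "eventually (\<lambda>u. dist (f u) p < \<rho>) (at_right a)"
    using assms(1) *(3) by (rule tendstoD)
  with assms(2) assms(3)[OF *(1,2)]
  have "eventually (\<lambda>u. f u \<in> L \<and> f u \<in> angular_cone p \<gamma> \<eta> \<and> cmod (f u - p) < \<rho>) (at_right a)"
    by eventually_elim (simp add: dist_norm)
  then have "\<exists>u. f u \<in> L \<and> f u \<in> angular_cone p \<gamma> \<eta> \<and> cmod (f u - p) < \<rho>"
    by (rule eventually_happens'[OF trivial_limit_at_right_real])
  then show "\<exists>z\<in>L. z \<in> angular_cone p \<gamma> \<eta> \<and> cmod (z - p) < \<rho>" by blast
qed

lemma petal_out_ray:
  assumes "knot g" and R: "reduced_period g p t\<^sub>0 R" "petal_arc g p t\<^sub>0 a e"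
    and l: "lagr_dir g a = of_real l * cis \<gamma>" "0 < l"
  shows "has_ray (loop_at g p R a) p \<gamma>"
proof (rule has_ray_eventually)
  obtain \<epsilon> where e: "0 < \<epsilon>"
    "\<And>u. a \<le> u \<Longrightarrow> u < e \<Longrightarrow> cmod (lagr g u - p) < \<epsilon> \<Longrightarrow> lagr g u \<in> loop_at g p R a"
    using near_multi_crossing_in_loop[OF R] by blast
  have ae: "a < e" "lagr g a = p" using R by (auto simp: petal_arc_def)
  have "isCont (lagr g) a"
    using has_vector_derivative_continuous lagr_derivative(1)[OF assms(1)] by blast
  then show lim: "(lagr g \<longlongrightarrow> p) (at_right a)"
    using ae by (auto simp: isCont_def intro: tendsto_within_subset)
  have "eventually (\<lambda>u. dist (lagr g u) p < \<epsilon>) (at_right a)"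
    using lim e(1) by (rule tendstoD)
  moreover have "eventually (\<lambda>u. a < u \<and> u < e) (at_right a)"
    using ae unfolding eventually_at_right_field by (intro exI[of _ e]) auto
  ultimately show "eventually (\<lambda>u. lagr g u \<in> loop_at g p R a) (at_right a)"
    by (rule eventually_elim2) (auto simp: dist_norm intro: e(2))
  show "eventually (\<lambda>u. lagr g u \<in> angular_cone p \<gamma> \<eta>) (at_right a)" if "0 < \<eta>" "\<eta> < pi" for \<eta>
    using eventually_in_tangent_cone[of "lagr g" l \<gamma> a \<eta>] lagr_derivative(1)[OF assms(1), of a] l that ae
    by simp
qed

lemma petal_in_ray:
  assumes "knot g" and R: "reduced_period g p t\<^sub>0 R" "petal_arc g p t\<^sub>0 a e"
    and l: "- lagr_dir g e = of_real l * cis \<gamma>" "0 < l"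
  shows "has_ray (loop_at g p R a) p \<gamma>"
proof (rule has_ray_eventually)
  obtain \<epsilon> where e: "0 < \<epsilon>"
    "\<And>u. a \<le> u \<Longrightarrow> u < e \<Longrightarrow> cmod (lagr g u - p) < \<epsilon> \<Longrightarrow> lagr g u \<in> loop_at g p R a"
    using near_multi_crossing_in_loop[OF R] by blast
  have ae: "a < e" "lagr g e = p" using R by (auto simp: petal_arc_def)
  have "(uminus has_vector_derivative - 1) (at (- e))"
    by (auto intro!: derivative_eq_intros)
  from vector_diff_chain_at[OF this, of "lagr g" "lagr_dir g e"] lagr_derivative(1)[OF assms(1), of e]
  have d: "((\<lambda>u. lagr g (- u)) has_vector_derivative of_real l * cis \<gamma>) (at (- e))"
    by (simp add: o_def l)
  have "isCont (\<lambda>u. lagr g (- u)) (- e)"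
    using has_vector_derivative_continuous d by blast
  then show lim: "((\<lambda>u. lagr g (- u)) \<longlongrightarrow> p) (at_right (- e))"
    using ae by (auto simp: isCont_def intro: tendsto_within_subset)
  have "eventually (\<lambda>u. dist (lagr g (- u)) p < \<epsilon>) (at_right (- e))"
    using lim e(1) by (rule tendstoD)
  moreover have "eventually (\<lambda>u. - e < u \<and> u < - a) (at_right (- e))"
    using ae unfolding eventually_at_right_field by (intro exI[of _ "- a"]) auto
  ultimately show "eventually (\<lambda>u. lagr g (- u) \<in> loop_at g p R a) (at_right (- e))"
    by (rule eventually_elim2) (auto simp: dist_norm intro: e(2))
  show "eventually (\<lambda>u. lagr g (- u) \<in> angular_cone p \<gamma> \<eta>) (at_right (- e))" if "0 < \<eta>" "\<eta> < pi" for \<eta>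
    using eventually_in_tangent_cone[OF d l(2) that] ae by simp
qed

lemma ray_enters_sector:
  assumes "has_ray L p \<gamma>" "0 < \<eta>" "\<eta> < pi" "0 < \<rho>" "\<gamma>\<^sub>1 + \<eta> \<le> \<gamma>" "\<gamma> + \<eta> \<le> \<gamma>\<^sub>2"
  shows "L \<inter> sector p \<rho> \<gamma>\<^sub>1 \<gamma>\<^sub>2 \<noteq> {}"
proof -
  obtain z where z: "z \<in> L" "z \<in> angular_cone p \<gamma> \<eta>" "cmod (z - p) < \<rho>"
    using assms by (auto simp: has_ray_def)
  obtain \<gamma>' where g: "\<bar>\<gamma>' - \<gamma>\<bar> < \<eta>" "z = p + of_real (cmod (z - p)) * cis \<gamma>'" "z \<noteq> p"
    using angular_cone_polar[OF z(2) assms(2,3)] by blast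
  have "z \<in> sector p \<rho> \<gamma>\<^sub>1 \<gamma>\<^sub>2"
    unfolding sector_def
  proof (rule image_eqI[of _ _ "(cmod (z - p), \<gamma>')"])
    show "(cmod (z - p), \<gamma>') \<in> {0<..<\<rho>} \<times> {\<gamma>\<^sub>1..\<gamma>\<^sub>2}" using g(1,3) z(3) assms by auto
  qed (use g in simp)
  then show ?thesis using z by blast
qed

text \<open>One of the two sectors at \<open>p\<close> bounded by the rays of a petal is inside the petal; a ray of
  another petal in that sector would make the two nested.\<close>

lemma no_rays_on_both_sides_of_petal:
  assumes "knot g" and R: "reduced_period g p t\<^sub>0 R" "petal_arc g p t\<^sub>0 a e"
    and crossings: "no_other_crossing g p R" "no_nested_loops g p R"
    and out: "lagr_dir g a = of_real l * cis \<alpha>" "0 < l"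
    and inn: "- lagr_dir g e = of_real m * cis \<beta>" "0 < m"
    and b: "b \<in> R" "lagr g b = p" "b \<noteq> a" "has_ray (loop_at g p R b) p \<gamma>" "\<alpha> < \<gamma>" "\<gamma> < \<beta>"
    and b': "b' \<in> R" "lagr g b' = p" "b' \<noteq> a" "has_ray (loop_at g p R b') p \<gamma>'" "\<beta> < \<gamma>'" "\<gamma>' < \<alpha> + 2 * pi"
  shows False
proof -
  let ?L = "loop_at g p R a"
  \<comment> \<open>The opening of the cones around the four directions must be small against all four gaps.\<close>
  define \<eta> where "\<eta> = min (min (\<gamma> - \<alpha>) (\<beta> - \<gamma>)) (min (\<gamma>' - \<beta>) (\<alpha> + 2 * pi - \<gamma>')) / 3"
  have eta: "0 < \<eta>" "3 * \<eta> \<le> \<gamma> - \<alpha>" "3 * \<eta> \<le> \<beta> - \<gamma>" "3 * \<eta> \<le> \<gamma>' - \<beta>" "3 * \<eta> \<le> \<alpha> + 2 * pi - \<gamma>'"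
    using b(5,6) b'(5,6) by (auto simp: \<eta>_def min_def)
  note Rin = petal_arc_in_period[OF R]
  have ae: "a < e" "lagr g a = p" "lagr g e = p" "\<And>u. a < u \<Longrightarrow> u < e \<Longrightarrow> lagr g u \<noteq> p"
    using R by (auto simp: petal_arc_def)
  obtain \<epsilon> where e: "0 < \<epsilon>"
    "\<And>u. a \<le> u \<Longrightarrow> u < e \<Longrightarrow> cmod (lagr g u - p) < \<epsilon> \<Longrightarrow> lagr g u \<in> ?L"
    using near_multi_crossing_in_loop[OF R] by blast
  have L: "?L \<subseteq> lagr g ` {a..e}" by (subst petal_arc_loop[OF R]) auto
  have cl: "?L \<subseteq> closure (inside ?L)"
    using petal_in_closure_inside[OF R(1) crossings(1) Rin(1,2) ae] by blast
  have small: "\<alpha> + 2 * \<eta> < \<beta>" "\<beta> + 2 * \<eta> < \<alpha> + 2 * pi"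
    using eta b(5,6) b'(5,6) by linarith+
  obtain \<rho> where rho: "0 < \<rho>" "sector p \<rho> (\<alpha> + \<eta>) (\<beta> - \<eta>) \<subseteq> inside ?L
       \<or> sector p \<rho> (\<beta> + \<eta>) (\<alpha> + 2 * pi - \<eta>) \<subseteq> inside ?L"
    by (rule petal_fills_a_sector[OF lagr_derivative(1)[OF assms(1)] lagr_derivative(2)[OF assms(1)]
        ae out inn L cl e eta(1) small]; use that in blast)
  have "loop_at g p R b \<inter> sector p \<rho> (\<alpha> + \<eta>) (\<beta> - \<eta>) \<noteq> {}"
    using eta b(5,6) b'(5,6) by (intro ray_enters_sector[OF b(4) _ _ rho(1), of \<eta>]) auto
  moreover have "loop_at g p R b' \<inter> sector p \<rho> (\<beta> + \<eta>) (\<alpha> + 2 * pi - \<eta>) \<noteq> {}"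
    using eta b(5,6) b'(5,6) by (intro ray_enters_sector[OF b'(4) _ _ rho(1), of \<eta>]) auto
  ultimately show False
    using rho(2) crossings(2) b(1-3) b'(1-3) Rin(1) ae(2) unfolding no_nested_loops_def by blast
qed

lemma petal_arc_ends_unique:
  assumes "petal_arc g p t\<^sub>0 a e" "petal_arc g p t\<^sub>0 a e'"
  shows "e = e'"
  using assms unfolding petal_arc_def by (metis linorder_cases)

text \<open>The petal that returns to the visit \<open>b\<close> starts at the previous visit; for the first visit of
  the period this is the last one, one period earlier.\<close>

lemma petal_arc_into:
  assumes per: "lagr g (t\<^sub>0 + 1) = p" and V: "V = {t \<in> {t\<^sub>0..<t\<^sub>0 + 1}. lagr g t = p}" "finite V" "t\<^sub>0 \<in> V"
    and b: "b \<in> V"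
  shows "\<exists>a\<in>V. \<exists>e. petal_arc g p t\<^sub>0 a e \<and> (e = b \<or> e = b + 1)"
proof (cases "b = t\<^sub>0")
  case True
  define a where "a = Max V"
  have aV: "a \<in> V" unfolding a_def by (rule Max_in) (use V(2,3) in auto)
  have max: "u \<le> a" if "u \<in> V" for u unfolding a_def using V(2) that by (rule Max_ge)
  note aV
  moreover have "lagr g u \<noteq> p" if "a < u" "u < t\<^sub>0 + 1" for u
    using max[of u] that aV unfolding V(1) by auto
  ultimately have "petal_arc g p t\<^sub>0 a (t\<^sub>0 + 1)" using per V(1) by (auto simp: petal_arc_def)
  then show ?thesis using True \<open>a \<in> V\<close> by auto
next
  case False
  define W where "W = {u \<in> V. u < b}"
  define a where "a = Max W"
  have "finite W" by (simp add: W_def V(2))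
  moreover have "t\<^sub>0 \<in> W" using V(3) b False unfolding W_def V(1) by auto
  ultimately have "finite W" "t\<^sub>0 \<in> W" by simp_all
  then have aW: "a \<in> W" unfolding a_def by (intro Max_in) auto
  have max: "u \<le> a" if "u \<in> W" for u unfolding a_def using \<open>finite W\<close> that by (rule Max_ge)
  note aW
  moreover have "lagr g u \<noteq> p" if "a < u" "u < b" for u
    using max[of u] that aW b unfolding W_def V(1) by auto
  ultimately have "petal_arc g p t\<^sub>0 a b" using b V(1) by (auto simp: petal_arc_def W_def)
  then show ?thesis using \<open>a \<in> W\<close> by (auto simp: W_def)
qed

section \<open>Combinatorics of cyclically ordered rays\<close>

text \<open>Since \<open>P\<close> alternates and \<open>n\<close> is odd, one of \<open>P r\<close> and \<open>P (r + n)\<close> holds; in the second case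
  the conclusion is carried back from \<open>r + n\<close> to \<open>r\<close>.\<close>

lemma alternation_from_parity:
  fixes P c :: "int \<Rightarrow> bool"
  assumes "odd n" and P: "\<And>r. P r \<longleftrightarrow> \<not> P (r - 1)" and "\<And>r. P r \<Longrightarrow> c r \<noteq> c (r + 1)"
    and c: "\<And>r. c (r + int n) \<longleftrightarrow> \<not> c r"
  shows "c (r + 1) \<noteq> c r"
proof -
  have "P (r + int m) \<longleftrightarrow> (P r \<longleftrightarrow> even m)" for m
  proof (induction m)
    case (Suc m)
    have "P (r + int (Suc m)) \<longleftrightarrow> \<not> P (r + int m)"
      using P[of "r + int (Suc m)"] by (simp add: algebra_simps)
    then show ?case using Suc by simp
  qed simp
  then have "P r \<or> P (r + int n)" using \<open>odd n\<close> by blast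
  then show ?thesis
    using assms(3)[of r] assms(3)[of "r + int n"] c[of r] c[of "r + 1"]
    by (auto simp: algebra_simps)
qed

text \<open>The rays are indexed by the integers, in counterclockwise order and with period \<open>2n\<close>; \<open>c r\<close> says
  that ray \<open>r\<close> is outgoing, and \<open>loop r\<close> is the petal to which the ray belongs. Every
  petal has exactly one ray of each orientation (\<open>uniq\<close>, \<open>other_end\<close>). As there are no other rays on
  one of its sides, its two rays are neighbours, so ray \<open>r\<close> shares its petal with exactly one of
  \<open>r - 1\<close> and \<open>r + 1\<close>.\<close>

lemma rays_alternate:
  fixes n :: nat and c :: "int \<Rightarrow> bool" and loop :: "int \<Rightarrow> 'a"
  assumes n: "odd n" "2 \<le> n" and c: "\<And>r. c (r + int n) \<longleftrightarrow> \<not> c r"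
    and per: "\<And>r m. loop (r + 2 * int n * m) = loop r"
    and uniq: "\<And>r s. loop r = loop s \<Longrightarrow> c r = c s \<Longrightarrow> 2 * int n dvd r - s"
    and other_end: "\<And>r. \<exists>s. loop s = loop r \<and> c s \<noteq> c r"
    and no_rays_on_both_sides: "\<And>r s x y. loop r = loop s \<Longrightarrow> c r \<Longrightarrow> \<not> c s \<Longrightarrow> r < x \<Longrightarrow> x < s \<Longrightarrow> s < y
      \<Longrightarrow> y < r + 2 * int n \<Longrightarrow> loop x \<noteq> loop r \<Longrightarrow> loop y \<noteq> loop r \<Longrightarrow> False"
  shows "c (r + 1) \<noteq> c r"
proof (rule alternation_from_parity[OF n(1), where P = "\<lambda>r. loop r = loop (r + 1)"])
  show "c (r + int n) \<longleftrightarrow> \<not> c r" for r by (rule c)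
  have small: "\<not> 2 * int n dvd r - s" if "r \<noteq> s" "\<bar>r - s\<bar> < 2 * int n" for r s
    using that zdvd_not_zless[of "\<bar>r - s\<bar>" "2 * int n"] by auto
  show "c r \<noteq> c (r + 1)" if "loop r = loop (r + 1)" for r
    using uniq[OF that] small[of r "r + 1"] n by auto
  have c2: "c (r + 2 * int n * m) = c r" for r m
  proof -
    have nat: "c (r + 2 * int n * int k) = c r" for r k
    proof (induction k)
      case (Suc k)
      have "r + 2 * int n * int (Suc k) = r + 2 * int n * int k + int n + int n"
        by (simp add: algebra_simps)
      then show ?case using Suc c by metis
    qed simp
    show ?thesis
      using nat[of r "nat m"] nat[of "r + 2 * int n * m" "nat (- m)"] by (cases "m \<ge> 0") auto
  qed
  show "loop r = loop (r + 1) \<longleftrightarrow> loop (r - 1) \<noteq> loop (r - 1 + 1)" for r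
  proof
    assume 1: "loop r = loop (r + 1)"
    show "loop (r - 1) \<noteq> loop (r - 1 + 1)"
    proof
      assume "loop (r - 1) = loop (r - 1 + 1)"
      with 1 have "2 * int n dvd r - 1 - r \<or> 2 * int n dvd r - (r + 1) \<or> 2 * int n dvd r - 1 - (r + 1)"
        using uniq[of "r - 1" r] uniq[of r "r + 1"] uniq[of "r - 1" "r + 1"] by auto
      then show False using small[of "r - 1" r] small[of r "r + 1"] small[of "r - 1" "r + 1"] n(2) by auto
    qed
  next
    assume 1: "loop (r - 1) \<noteq> loop (r - 1 + 1)"
    show "loop r = loop (r + 1)"
    proof (rule ccontr)
      assume 2: "loop r \<noteq> loop (r + 1)"
      obtain s' where s': "loop s' = loop r" "c s' \<noteq> c r" using other_end by blast
      \<comment> \<open>The other ray of the petal of \<open>r\<close>, taken within the next full turn.\<close>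
      define s where "s = r + (s' - r) mod (2 * int n)"
      have "s = s' + 2 * int n * (- ((s' - r) div (2 * int n)))"
        by (simp add: s_def minus_mult_div_eq_mod[symmetric] algebra_simps)
      then have s: "loop s = loop r" "c s \<noteq> c r"
        using per[of s'] c2[of s'] s' by metis+
      have "r \<le> s" "s < r + 2 * int n" using n by (auto simp: s_def)
      moreover have "s \<noteq> r" "s \<noteq> r + 1" using s 2 by auto
      moreover have "s \<noteq> r - 1 + 2 * int n" using s 1 per[of "r - 1" 1] by auto
      ultimately have rs: "r + 1 < s" "s + 1 < r + 2 * int n" by auto
      have s1: "loop (s + 1) \<noteq> loop r"
      proof
        assume "loop (s + 1) = loop r"
        then have "2 * int n dvd s + 1 - s \<or> 2 * int n dvd s + 1 - r"
          using uniq[of "s + 1" s] uniq[of "s + 1" r] s by auto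
        then show False using small[of "s + 1" s] small[of "s + 1" r] rs by auto
      qed
      show False
      proof (cases "c r")
        case True
        then show False
          using no_rays_on_both_sides[of r s "r + 1" "s + 1"] s s1 2 rs by auto
      next
        case False
        then show False
          using no_rays_on_both_sides[of s "r + 2 * int n" "s + 1" "r + 1 + 2 * int n"] s s1 2 rs
            per[of r 1] per[of "r + 1" 1] c2[of r 1] by auto
      qed
    qed
  qed
qed

section \<open>Directions of consecutive strands\<close>

text \<open>With \<open>Arg2pi\<close> in \<open>[pi/2, 3pi/2)\<close>, the left ends of the strands followed by their right ends list all
  rays in counterclockwise order.\<close>

lemma left_end_polar:
  assumes "v \<noteq> 0"
  defines "\<theta> \<equiv> Arg2pi (left_end v)"
  shows "left_end v = of_real (cmod v) * cis \<theta>" "pi / 2 \<le> \<theta>" "\<theta> < 3 * pi / 2"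
proof -
  let ?w = "left_end v"
  have nw: "cmod ?w = cmod v" by (simp add: left_end_def)
  have w: "?w = of_real (cmod ?w) * cis \<theta>"
    unfolding \<theta>_def by (metis Arg2pi_eq cis_conv_exp mult.commute)
  then show "left_end v = of_real (cmod v) * cis \<theta>" using nw by simp
  have "Re ?w < 0 \<or> Re ?w = 0 \<and> Im ?w > 0"
    using assms(1) by (auto simp: left_end_def complex_eq_iff)
  moreover have "Re ?w = cmod v * cos \<theta>" "Im ?w = cmod v * sin \<theta>"
    by (subst w, simp add: nw)+
  ultimately have sgn: "cos \<theta> < 0 \<or> cos \<theta> = 0 \<and> sin \<theta> > 0"
    using assms(1) by (auto simp: mult_less_0_iff zero_less_mult_iff)
  have \<theta>: "0 \<le> \<theta>" "\<theta> < 2 * pi" using Arg2pi_ge_0 Arg2pi_lt_2pi by (auto simp: \<theta>_def)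
  show "pi / 2 \<le> \<theta>"
  proof (rule ccontr)
    assume "\<not> pi / 2 \<le> \<theta>"
    then have "cos \<theta> > 0" using \<theta> by (intro cos_gt_zero_pi) auto
    then show False using sgn by simp
  qed
  show "\<theta> < 3 * pi / 2"
  proof (rule ccontr)
    assume *: "\<not> \<theta> < 3 * pi / 2"
    then have "cos (2 * pi - \<theta>) \<ge> 0" using \<theta> by (intro cos_ge_zero) auto
    then have "cos \<theta> = 0" "sin \<theta> > 0" using sgn by (auto simp: cos_diff)
    moreover have "sin (2 * pi - \<theta>) > 0" using * \<theta> by (intro sin_gt_zero) auto
    ultimately show False by (simp add: sin_diff)
  qed
qed

lemma cis_pi_int: "cis (pi * of_int m) = (if even m then 1 else - 1)"
  by (simp add: complex_eq_iff cos_npi_int sin_npi_int)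

text \<open>Ray \<open>n q + i\<close> with \<open>1 \<le> i \<le> n\<close> is the end of strand \<open>i\<close> obtained from its left end by \<open>q\<close> half turns.
  It is outgoing if the left end is and \<open>q\<close> is even, or if neither holds. An outgoing ray
  belongs to the petal that starts at its visit of \<open>p\<close>, an incoming one to the petal before it. With these data
  \<open>rays_alternate\<close> applies, and rays \<open>1, \<dots>, n\<close> are the left ends of the strands.\<close>

lemma strand_directions_alternate:
  assumes g: "knot g" and petal: "lagrangian_petal_projection g p n k"
    and lab: "strand_labelling g p n \<tau>" and n2: "2 \<le> n"
  defines "v \<equiv> \<lambda>i. lagr_dir g (\<tau> i)"
  shows "\<And>i. 1 \<le> i \<Longrightarrow> i \<le> n \<Longrightarrow> v i \<noteq> 0"
    and "\<And>i. 1 \<le> i \<Longrightarrow> i < n \<Longrightarrow> (left_end (v (Suc i)) = v (Suc i)) \<noteq> (left_end (v i) = v i)"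
proof -
  obtain t\<^sub>0 where odd: "odd n" and mc: "multi_crossing g p n"
    and t0: "lagr g t\<^sub>0 = p" and tw: "twisted_petals g p {t\<^sub>0..<t\<^sub>0 + 1} k"
    using petal by (auto simp: lagrangian_petal_projection_def)
  have bij: "bij_betw \<tau> {1..n} (strands g p)"
    and increasing: "\<And>i j. 1 \<le> i \<Longrightarrow> i < j \<Longrightarrow> j \<le> n \<Longrightarrow> Arg2pi (left_end (v i)) < Arg2pi (left_end (v j))"
    using lab by (auto simp: strand_labelling_def v_def)
  show v0: "v i \<noteq> 0" if i: "1 \<le> i" "i \<le> n" for i
  proof -
    define j :: nat where "j = (if i = 1 then 2 else 1)"
    have "j \<in> {1..n}" "j \<noteq> i" using n2 by (auto simp: j_def)
    then have "\<tau> i \<noteq> \<tau> j" "\<tau> i \<in> strands g p" "\<tau> j \<in> strands g p"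
      using bij_betwE[OF bij] inj_onD[OF bij_betw_imp_inj_on[OF bij], of i j] i by auto
    then have "plane_det (v i) (v j) \<noteq> 0" using mc by (auto simp: multi_crossing_def v_def)
    then show ?thesis by (auto simp: plane_det_def)
  qed

  \<comment> \<open>The visits of \<open>p\<close> in the period from which the half-twists are removed.\<close>
  define T where "T = into_period t\<^sub>0 \<circ> \<tau>"
  define V where "V = {t \<in> {t\<^sub>0..<t\<^sub>0 + 1}. lagr g t = p}"
  note lagr = into_period_periodic[of "lagr g" t\<^sub>0, OF lagr_derivative(3)[OF g]]
  note dir = into_period_periodic[of "lagr_dir g" t\<^sub>0, OF lagr_derivative(4)[OF g]]
  have "into_period t\<^sub>0 ` strands g p = V"
    unfolding V_def strands_def bij_betw_imp_surj_on[OF bij_betw_into_period, of t\<^sub>0, symmetric]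
    by (auto simp: lagr)
  then have "bij_betw (into_period t\<^sub>0) (strands g p) V"
    by (rule bij_betw_subset[OF bij_betw_into_period, rotated]) (auto simp: strands_def)
  then have T: "bij_betw T {1..n} V" unfolding T_def using bij by (rule bij_betw_trans[rotated])
  have T_in: "T i \<in> V" if "1 \<le> i" "i \<le> n" for i using bij_betwE[OF T] that by simp
  have T_inj: "i = j" if "T i = T j" "1 \<le> i" "i \<le> n" "1 \<le> j" "j \<le> n" for i j
    using inj_onD[OF bij_betw_imp_inj_on[OF T] that(1)] that by simp
  have T_surj: "\<exists>i. 1 \<le> i \<and> i \<le> n \<and> b = T i" if "b \<in> V" for b
    using that unfolding bij_betw_imp_surj_on[OF T, symmetric] by auto
  have vT: "lagr_dir g (T i) = v i" for i by (simp add: T_def v_def dir)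
  have finV: "finite V" using bij_betw_finite[OF T] by simp
  have t0V: "t\<^sub>0 \<in> V" using t0 by (simp add: V_def)
  have per: "lagr g (t\<^sub>0 + 1) = p" using t0 lagr_derivative(3)[OF g] by simp
  define prv where "prv b = (SOME a. a \<in> V \<and> (\<exists>e. petal_arc g p t\<^sub>0 a e \<and> (e = b \<or> e = b + 1)))" for b
  have prv: "prv b \<in> V \<and> (\<exists>e. petal_arc g p t\<^sub>0 (prv b) e \<and> (e = b \<or> e = b + 1))" if "b \<in> V" for b
    unfolding prv_def
    by (rule someI_ex) (use petal_arc_into[OF per V_def finV t0V that] in blast)
  have prv_inj: "inj_on prv V"
  proof (rule inj_onI)
    fix b b' assume b: "b \<in> V" "b' \<in> V" "prv b = prv b'"
    obtain e where e: "petal_arc g p t\<^sub>0 (prv b) e" "e = b \<or> e = b + 1"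
      using prv[OF b(1)] by blast
    obtain e' where e': "petal_arc g p t\<^sub>0 (prv b) e'" "e' = b' \<or> e' = b' + 1"
      using prv[OF b(2)] unfolding b(3)[symmetric] by blast
    have "t\<^sub>0 \<le> b" "b < t\<^sub>0 + 1" "t\<^sub>0 \<le> b'" "b' < t\<^sub>0 + 1" using b(1,2) unfolding V_def by auto
    moreover have "e = e'" by (rule petal_arc_ends_unique[OF e(1) e'(1)])
    ultimately show "b = b'" using e(2) e'(2) by linarith
  qed
  have prv_surj: "prv ` V = V"
    by (rule endo_inj_surj[OF finV _ prv_inj]) (use prv in auto)
  have "reduced_period g p t\<^sub>0 {t\<^sub>0..<t\<^sub>0 + 1}"
    unfolding reduced_period_def using traversal_id[OF lagr_derivative(5)[OF g]]
    by (auto intro: exI[of _ 1] exI[of _ id])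
  then obtain R
    where R: "reduced_period g p t\<^sub>0 R" "no_other_crossing g p R" "no_nested_loops g p R"
    using untwisting[OF tw _ lagr_derivative(5)[OF g]] by blast

  \<comment> \<open>Rays are numbered from 1, as strands are.\<close>
  define quot where "quot r = (r - 1) div int n" for r
  define idx where "idx r = nat ((r - 1) mod int n) + 1" for r
  define c where "c r \<longleftrightarrow> (even (quot r) \<longleftrightarrow> left_end (v (idx r)) = v (idx r))" for r
  define ang where "ang r = Arg2pi (left_end (v (idx r))) + pi * of_int (quot r)" for r
  define loop where "loop r = (if c r then T (idx r) else prv (T (idx r)))" for r
  have n0: "int n > 0" using n2 by simp
  have index: "quot (int n * q + int i) = q" "idx (int n * q + int i) = i" if "1 \<le> i" "i \<le> n" for q i
  proof -
    have eq: "int n * q + int i - 1 = int n * q + (int i - 1)" by simp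
    have dm: "(int n * q + (int i - 1)) div int n = q" "(int n * q + (int i - 1)) mod int n = int i - 1"
      using that n0 by (simp_all add: div_pos_pos_trivial)
    show "quot (int n * q + int i) = q" "idx (int n * q + int i) = i"
      unfolding quot_def idx_def eq dm using that by simp_all
  qed
  have indexD: "quot r = q" "idx r = i" if "r = int n * q + int i" "1 \<le> i" "i \<le> n" for r q i
    using index[OF that(2,3)] unfolding that(1) by simp_all
  have idx: "1 \<le> idx r" "idx r \<le> n" "r = int n * quot r + int (idx r)" for r
  proof -
    have "0 \<le> (r - 1) mod int n" "(r - 1) mod int n < int n" using n0 by simp_all
    moreover have "r - 1 = int n * quot r + (r - 1) mod int n"
      unfolding quot_def by (simp add: mult_div_mod_eq)
    moreover have "int (idx r) = (r - 1) mod int n + 1" using n0 by (simp add: idx_def)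
    ultimately show "1 \<le> idx r" "idx r \<le> n" "r = int n * quot r + int (idx r)"
      by linarith+
  qed
  have TV: "T (idx r) \<in> V" for r using T_in idx by blast
  have shift: "quot (r + int n * m) = quot r + m" "idx (r + int n * m) = idx r" for r m
  proof -
    have "r + int n * m = int n * (quot r + m) + int (idx r)"
      using idx(3)[of r] by (simp add: algebra_simps)
    from indexD[OF this idx(1,2)]
    show "quot (r + int n * m) = quot r + m" "idx (r + int n * m) = idx r" by simp_all
  qed
  have c_shift: "c (r + int n) \<longleftrightarrow> \<not> c r" for r
    using shift[of r 1] by (auto simp: c_def)
  have ang_shift: "ang (r + 2 * int n) = ang r + 2 * pi" for r
    using shift[of r 2] by (simp add: ang_def algebra_simps)
  have ang_step: "ang r < ang (r + 1)" for r
  proof (cases "idx r = n")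
    case True
    then have "r + 1 = int n * (quot r + 1) + int 1" using idx(3)[of r] by (simp add: algebra_simps)
    from indexD[OF this] have "quot (r + 1) = quot r + 1" "idx (r + 1) = 1" using n2 by simp_all
    moreover have "Arg2pi (left_end (v n)) < Arg2pi (left_end (v 1)) + pi"
      using left_end_polar(3)[OF v0[of n]] left_end_polar(2)[OF v0[of 1]] n2 by simp
    ultimately show ?thesis using True by (simp add: ang_def algebra_simps)
  next
    case False
    then have *: "idx r < n" using idx(2)[of r] by simp
    have "r + 1 = int n * quot r + int (Suc (idx r))" using idx(3)[of r] by simp
    from indexD[OF this] have "quot (r + 1) = quot r" "idx (r + 1) = Suc (idx r)" using * by simp_all
    then show ?thesis using increasing[of "idx r" "Suc (idx r)"] idx(1)[of r] * by (simp add: ang_def)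
  qed
  have ang_mono: "ang r < ang s" if "r < s" for r s
  proof -
    have "ang r < ang (r + 1 + int k)" for k
    proof (induction k)
      case (Suc k)
      then show ?case using ang_step[of "r + 1 + int k"] by (simp add: algebra_simps)
    qed (simp add: ang_step)
    from this[of "nat (s - r - 1)"] show ?thesis using that by simp
  qed
  have ray_dir: "(if c r then v (idx r) else - v (idx r)) = of_real (cmod (v (idx r))) * cis (ang r)" for r
  proof -
    have "of_real (cmod (v (idx r))) * cis (ang r) = left_end (v (idx r)) * (if even (quot r) then 1 else - 1)"
      unfolding ang_def cis_mult[symmetric] cis_pi_int
      by (subst left_end_polar(1)[OF v0[OF idx(1,2)]]) simp
    moreover have "left_end (v (idx r)) = v (idx r) \<or> left_end (v (idx r)) = - v (idx r)"
      by (simp add: left_end_def)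
    ultimately show ?thesis by (auto simp: c_def)
  qed
  have pos: "cmod (v (idx r)) > 0" for r using v0[OF idx(1,2)] by simp
  have loopV: "loop r \<in> V" for r using TV prv by (auto simp: loop_def)
  have arc: "\<exists>e. petal_arc g p t\<^sub>0 a e" if "a \<in> V" for a
  proof -
    have "a \<in> prv ` V" using that by (simp only: prv_surj)
    then obtain b where "b \<in> V" "a = prv b" by (rule imageE)
    then show ?thesis using prv[of b] by blast
  qed
  have in_arc: "\<exists>e. petal_arc g p t\<^sub>0 (loop r) e \<and> - lagr_dir g e = of_real (cmod (v (idx r))) * cis (ang r)"
    if "\<not> c r" for r
  proof -
    obtain e where e: "petal_arc g p t\<^sub>0 (prv (T (idx r))) e" "e = T (idx r) \<or> e = T (idx r) + 1"
      using prv[OF TV] by blast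
    from e(2) have "lagr_dir g e = v (idx r)"
      using vT[of "idx r"] lagr_derivative(4)[OF g, of "T (idx r)"] by (elim disjE) simp_all
    then show ?thesis using e(1) ray_dir[of r] that by (intro exI[of _ e]) (simp add: loop_def)
  qed
  have ray: "has_ray (loop_at g p R (loop r)) p (ang r)" for r
  proof (cases "c r")
    case True
    obtain e where "petal_arc g p t\<^sub>0 (loop r) e" using arc loopV by blast
    then show ?thesis
      using petal_out_ray[OF g R(1) _ _ pos] ray_dir[of r] True vT by (simp add: loop_def)
  next
    case False
    obtain e where "petal_arc g p t\<^sub>0 (loop r) e" "- lagr_dir g e = of_real (cmod (v (idx r))) * cis (ang r)"
      using in_arc[OF False] by blast
    then show ?thesis by (rule petal_in_ray[OF g R(1) _ _ pos])
  qed
  have VR: "V \<subseteq> R" using petal_arc_in_period(1)[OF R(1)] arc by blast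
  have alt: "c (r + 1) \<noteq> c r" for r
  proof (rule rays_alternate[OF odd n2, where loop = loop])
    show "c (r + int n) \<longleftrightarrow> \<not> c r" for r by (rule c_shift)
    show "loop (r + 2 * int n * m) = loop r" for r m
      using shift[of r "2 * m"] by (simp add: loop_def c_def mult.assoc mult.left_commute[of 2])
    show "2 * int n dvd r - s" if "loop r = loop s" "c r = c s" for r s
    proof -
      have "T (idx r) = T (idx s)"
        using that inj_onD[OF prv_inj _ TV TV] by (auto simp: loop_def split: if_splits)
      then have i: "idx r = idx s"
        using T_inj idx by blast
      then have "even (quot r - quot s)" using that(2) by (auto simp: c_def)
      moreover have "r - s = int n * (quot r - quot s)"
        using idx(3)[of r] idx(3)[of s] i by (simp add: algebra_simps)
      ultimately show ?thesis by (metis dvd_refl mult.commute mult_dvd_mono)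
    qed
    \<comment> \<open>Both ends of strand \<open>i\<close> are rays, and exactly one of them is outgoing.\<close>
    have given: "\<exists>s. idx s = i \<and> c s = x" if "1 \<le> i" "i \<le> n" for i x
    proof -
      have "idx (int i) = i" using index[OF that, of 0] by simp
      moreover from this have "idx (int i + int n) = i" using shift[of "int i" 1] by simp
      ultimately show ?thesis using c_shift[of "int i"] by (cases "c (int i) = x") auto
    qed
    show "\<exists>s. loop s = loop r \<and> c s \<noteq> c r" for r
    proof (cases "c r")
      case True
      have "loop r \<in> prv ` V" using loopV[of r] by (simp only: prv_surj)
      then obtain b where b: "b \<in> V" "prv b = loop r" by (metis imageE)
      then obtain i where "1 \<le> i" "i \<le> n" "b = T i" using T_surj by blast
      then obtain s where "idx s = i" "\<not> c s" using given[of i False] by auto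
      then show ?thesis using b \<open>b = T i\<close> True by (intro exI[of _ s]) (auto simp: loop_def)
    next
      case False
      obtain i where "1 \<le> i" "i \<le> n" "loop r = T i" using T_surj loopV[of r] by blast
      then obtain s where "idx s = i" "c s" using given[of i True] by auto
      then show ?thesis using \<open>loop r = T i\<close> False by (intro exI[of _ s]) (auto simp: loop_def)
    qed
    fix r s x y
    assume rs: "loop r = loop s" "c r" "\<not> c s" "r < x" "x < s" "s < y" "y < r + 2 * int n"
      and xy: "loop x \<noteq> loop r" "loop y \<noteq> loop r"
    obtain e where e: "petal_arc g p t\<^sub>0 (loop r) e"
      "- lagr_dir g e = of_real (cmod (v (idx s))) * cis (ang s)"
      using in_arc[OF rs(3)] rs(1) by auto
    have out: "lagr_dir g (loop r) = of_real (cmod (v (idx r))) * cis (ang r)"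
      using ray_dir[of r] rs(2) vT by (simp add: loop_def)
    have *: "loop q \<in> R" "lagr g (loop q) = p" for q
      using loopV[of q] VR by (auto simp: V_def)
    have angles: "ang r < ang x" "ang x < ang s" "ang s < ang y" "ang y < ang r + 2 * pi"
      using ang_mono[OF rs(4)] ang_mono[OF rs(5)] ang_mono[OF rs(6)] ang_mono[OF rs(7)] ang_shift[of r]
      by auto
    show False
      by (rule no_rays_on_both_sides_of_petal[OF g R(1) e(1) R(2,3) out pos e(2) pos
          * xy(1) ray angles(1,2) * xy(2) ray angles(3,4)])
  qed
  fix i assume i: "1 \<le> i" "i < n"
  have c_int: "c (int i) = (left_end (v i) = v i)" if "1 \<le> i" "i \<le> n" for i
    using index[OF that, of 0] by (simp add: c_def)
  show "(left_end (v (Suc i)) = v (Suc i)) \<noteq> (left_end (v i) = v i)"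
    using alt[of "int i"] c_int[of i] c_int[of "Suc i"] i by (simp add: add.commute)
qed

section \<open>The Thurston--Bennequin number\<close>

lemma plane_det_polar:
  "plane_det (of_real a * cis \<alpha>) (of_real b * cis \<beta>) = a * b * sin (\<beta> - \<alpha>)"
  by (simp add: plane_det_def sin_diff algebra_simps)

theorem theorem4p6:
  fixes \<Lambda> :: "real \<Rightarrow> real ^ 3" and p :: complex and n k :: nat
    and \<tau> :: "nat \<Rightarrow> real" and h :: "nat \<Rightarrow> nat"
  assumes "legendrian_knot \<Lambda>"
    and "lagrangian_petal_projection \<Lambda> p n k"
    and "strand_labelling \<Lambda> p n \<tau>"
    and "height_function \<Lambda> n \<tau> h"
  shows "tb \<Lambda> = - int k + (\<Sum>(i, j)\<in>{(i, j). 1 \<le> i \<and> i < j \<and> j \<le> n}. strand_sign h i j)"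
proof -
  have g: "knot \<Lambda>" using assms(1) by (simp add: legendrian_knot_def)
  have bij: "bij_betw \<tau> {1..n} (strands \<Lambda> p)" using assms(3) by (simp add: strand_labelling_def)
  have inj: "inj_on \<tau> {1..n}" using bij by (rule bij_betw_imp_inj_on)
  define v where "v i = lagr_dir \<Lambda> (\<tau> i)" for i
  define out where "out i \<longleftrightarrow> left_end (v i) = v i" for i
  define \<theta> where "\<theta> i = Arg2pi (left_end (v i))" for i
  have h: "h i > h j \<longleftrightarrow> \<Lambda> (\<tau> i) $ 3 > \<Lambda> (\<tau> j) $ 3" "i \<noteq> j \<Longrightarrow> h i \<noteq> h j"
    if "1 \<le> i" "i \<le> n" "1 \<le> j" "j \<le> n" for i j
  proof -
    have hb: "bij_betw h {1..n} {1..n}" using assms(4) by (simp add: height_function_def)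
    show "h i > h j \<longleftrightarrow> \<Lambda> (\<tau> i) $ 3 > \<Lambda> (\<tau> j) $ 3"
      using assms(4) that by (simp add: height_function_def)
    show "i \<noteq> j \<Longrightarrow> h i \<noteq> h j" using inj_onD[OF bij_betw_imp_inj_on[OF hb], of i j] that by auto
  qed
  have sign: "crossing_sign \<Lambda> (\<tau> i) (\<tau> j) = strand_sign h i j" if ij: "1 \<le> i" "i < j" "j \<le> n" for i j
  proof -
    have n2: "2 \<le> n" using ij by simp
    have alternate: "out (Suc l) \<noteq> out l" if "1 \<le> l" "l < n" for l
      using strand_directions_alternate(2)[OF g assms(2,3) n2 that] by (simp add: out_def v_def)
    have "out (i + m) \<longleftrightarrow> (out i \<longleftrightarrow> even m)" if "i + m \<le> n" for m
      using that
    proof (induction m)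
      case (Suc m)
      then show ?case using alternate[of "i + m"] ij by auto
    qed simp
    from this[of "j - i"] have parity: "out j \<longleftrightarrow> (out i \<longleftrightarrow> even (i + j))"
      using ij by (auto simp: even_diff_nat)
    have v0: "v i \<noteq> 0" "v j \<noteq> 0" using strand_directions_alternate(1)[OF g assms(2,3) n2] ij by (auto simp: v_def)
    define \<epsilon> where "\<epsilon> i = (if out i then 1 else - 1 :: real)" for i
    have v: "v l = of_real (\<epsilon> l * cmod (v l)) * cis (\<theta> l)" if "v l \<noteq> 0" for l
    proof -
      have "v l = of_real (\<epsilon> l) * left_end (v l)"
        by (auto simp: \<epsilon>_def out_def) (auto simp: left_end_def split: if_splits)
      then show ?thesis using left_end_polar(1)[OF that] by (simp add: \<theta>_def mult.assoc)
    qed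
    have "\<theta> i < \<theta> j" using assms(3) ij by (auto simp: strand_labelling_def \<theta>_def v_def)
    moreover have "\<theta> j - \<theta> i < pi"
      using left_end_polar(2)[OF v0(1)] left_end_polar(3)[OF v0(2)] by (simp add: \<theta>_def)
    ultimately have "sin (\<theta> j - \<theta> i) > 0" by (intro sin_gt_zero) auto
    define D where "D = cmod (v i) * cmod (v j) * sin (\<theta> j - \<theta> i)"
    have D: "D > 0" using \<open>sin (\<theta> j - \<theta> i) > 0\<close> v0 by (simp add: D_def)
    have "plane_det (v i) (v j) = \<epsilon> i * \<epsilon> j * D"
      unfolding D_def by (subst v[OF v0(1)], subst v[OF v0(2)], subst plane_det_polar) simp
    then have det: "plane_det (v i) (v j) = (if even (i + j) then D else - D)"
      using parity by (auto simp: \<epsilon>_def)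
    have det': "plane_det (v j) (v i) = - plane_det (v i) (v j)" by (simp add: plane_det_def)
    have above: "h i > h j \<longleftrightarrow> \<Lambda> (\<tau> i) $ 3 > \<Lambda> (\<tau> j) $ 3" and ne: "h i \<noteq> h j"
      using h[of i j] ij by auto
    have par: "parity_sum i j = (if even (i + j) then 0 else 1)"
      by (simp add: parity_sum_def even_iff_mod_2_eq_zero odd_iff_mod_2_eq_one)
    show ?thesis
      unfolding crossing_sign_def strand_sign_def v_def[symmetric] det' det above[symmetric] par
      using ne D by (cases "h i > h j"; cases "even (i + j)") (simp_all add: Let_def)
  qed
  have height: "\<Lambda> (\<tau> i) $ 3 \<noteq> \<Lambda> (\<tau> j) $ 3" if "i \<in> {1..n}" "j \<in> {1..n}" "i \<noteq> j" for i j
    using h[of i j] h[of j i] that by auto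
  obtain t\<^sub>0 where tw: "twisted_petals \<Lambda> p {t\<^sub>0..<t\<^sub>0 + 1} k" and fin: "finite (strands \<Lambda> p)"
    using assms(2) by (auto simp: lagrangian_petal_projection_def multi_crossing_def)
  let ?I = "{(i, j). (i \<in> {1..n} \<and> j \<in> {1..n}) \<and> i \<noteq> j}"
  have crossings: "ordered_crossings \<Lambda> (strands \<Lambda> p) = map_prod \<tau> \<tau> ` ?I"
  proof (intro equalityI subrelI)
    fix s t assume st: "(s, t) \<in> ordered_crossings \<Lambda> (strands \<Lambda> p)"
    then have "s \<in> \<tau> ` {1..n}" "t \<in> \<tau> ` {1..n}"
      unfolding bij_betw_imp_surj_on[OF bij] by (auto simp: ordered_crossings_def)
    then obtain i j where "i \<in> {1..n}" "j \<in> {1..n}" "s = \<tau> i" "t = \<tau> j" by blast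
    then show "(s, t) \<in> map_prod \<tau> \<tau> ` ?I"
      using st by (intro image_eqI[of _ _ "(i, j)"]) (auto simp: ordered_crossings_def)
  next
    fix s t assume "(s, t) \<in> map_prod \<tau> \<tau> ` ?I"
    then obtain i j where ij: "i \<in> {1..n}" "j \<in> {1..n}" "i \<noteq> j" "s = \<tau> i" "t = \<tau> j" by auto
    then have "s \<in> strands \<Lambda> p" "t \<in> strands \<Lambda> p" "s \<noteq> t"
      using bij_betwE[OF bij] inj_onD[OF inj, of i j] by auto
    then show "(s, t) \<in> ordered_crossings \<Lambda> (strands \<Lambda> p)"
      by (auto simp: ordered_crossings_def strands_def)
  qed
  have injI: "inj_on (map_prod \<tau> \<tau>) ?I"
    by (rule inj_on_subset[OF map_prod_inj_on[OF inj inj]]) auto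
  have "(\<Sum>(s, t)\<in>ordered_crossings \<Lambda> (strands \<Lambda> p). crossing_sign \<Lambda> s t)
      = (\<Sum>(i, j)\<in>?I. crossing_sign \<Lambda> (\<tau> i) (\<tau> j))"
    unfolding crossings sum.reindex[OF injI] by (simp add: case_prod_unfold)
  also have "\<dots> = 2 * (\<Sum>(i, j)\<in>{(i, j). (i \<in> {1..n} \<and> j \<in> {1..n}) \<and> i < j}. crossing_sign \<Lambda> (\<tau> i) (\<tau> j))"
  proof (rule sum_symmetric_pairs)
    show "finite ?I" by (rule finite_subset[of _ "{1..n} \<times> {1..n}"]) auto
    show "crossing_sign \<Lambda> (\<tau> i) (\<tau> j) = crossing_sign \<Lambda> (\<tau> j) (\<tau> i)"
      if "i \<in> {1..n} \<and> j \<in> {1..n}" "i \<noteq> j" for i j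
      using that by (intro crossing_sign_commute height) auto
  qed auto
  also have "{(i, j). (i \<in> {1..n} \<and> j \<in> {1..n}) \<and> i < j} = {(i, j). 1 \<le> i \<and> i < j \<and> j \<le> n}"
    by auto
  also have "(\<Sum>(i, j)\<in>\<dots>. crossing_sign \<Lambda> (\<tau> i) (\<tau> j))
      = (\<Sum>(i, j)\<in>{(i, j). 1 \<le> i \<and> i < j \<and> j \<le> n}. strand_sign h i j)"
    by (rule sum.cong) (auto simp: sign)
  finally show ?thesis using writhe_of_petals[OF g fin tw] by (simp add: tb_def)
qed

end
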